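(* The canonical morphism of affine ind-schemes $i:G\to\mathcal{G}$ is not an isomorphism of affine ind-schemes.
   Context: $R=\mathbb{C}\langle x,y\rangle$ is the free associative $\mathbb{C}$-algebra on $x,y$; $R^{(k)}$ is the finite-dimensional space of elements of degree $\le k$; $E=R\times R$ is identified with the set of algebra endomorphisms of $R$ via $\sigma\mapsto(\sigma(x),\sigma(y))$, and $E^{(k)}=R^{(k)}\times R^{(k)}$. Put $w=[x,y]=xy-yx$, and let $c:E\to R$, $c(p,q)=[p,q]$, with restrictions $c_k:E^{(k)}\to R^{(2k)}$, which are polynomial maps of finite-dimensional affine spaces. $G$ is the group of algebra automorphisms $\sigma$ of $R$ with $\sigma(w)=w$; as a set, $G=c^{-1}(w)$ (by a theorem of Dicks). An affine ind-scheme is a countable inductive limit of closed embeddings of affine $\mathbb{C}$-schemes. $G$ carries the reduced ind-variety structure with filtration $G^{(k)}=G\cap E^{(k)}=c_k^{-1}(w)$, a Zariski closed subset of $E^{(k)}$ with its reduced subvariety structure. $\mathcal{G}$ is the affine ind-scheme with filtration $\mathcal{G}^{(k)}=\mathrm{Spec}\,\bigl(\mathbb{C}[E^{(k)}]/(c_k^*(\mathfrak{m}_w))\bigr)$, the scheme-theoretic fibre of $c_k$ over $w$, where $\mathfrak{m}_w\subset\mathbb{C}[R^{(2k)}]$ is the maximal ideal of the point $w$ and $(c_k^*(\mathfrak m_w))$ denotes the ideal generated by $c_k^*(\mathfrak m_w)$. The morphism $i:G\to\mathcal{G}$ is induced by the projections $\mathbb{C}[\mathcal{G}^{(k)}]\twoheadrightarrow\mathbb{C}[\mathcal{G}^{(k)}]_{\mathrm{red}}=\mathbb{C}[G^{(k)}]$;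 it is the identity on underlying sets of closed points. *)

theory Defs
  imports
    "HOL-Library.Poly_Mapping"
    "HOL-Algebra.QuotRing"
    "HOL-Algebra.Module"
    "HOL-Algebra.Algebraic_Closure_Type"
begin

section \<open>Commutative algebras over the complex numbers\<close>

type_synonym 'a calg = "(complex, 'a) module"

abbreviation complex_ring :: "complex ring"
  where "complex_ring \<equiv> ring_of_type_algebra"

definition calg_hom :: "'a calg \<Rightarrow> 'b calg \<Rightarrow> ('a \<Rightarrow> 'b) set"
  where "calg_hom A B =
    {h \<in> ring_hom A B. \<forall>c. \<forall>a\<in>carrier A. h (c \<odot>\<^bsub>A\<^esub> a) = c \<odot>\<^bsub>B\<^esub> h a}"

definition quot_calg :: "'a calg \<Rightarrow> 'a set \<Rightarrow> 'a set calg"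
  where "quot_calg A J = ring.extend (A Quot J)
    (module.fields (\<lambda>c S. \<Union>a\<in>S. J +>\<^bsub>A\<^esub> (c \<odot>\<^bsub>A\<^esub> a)))"

section \<open>Affine ind-schemes\<close>

text \<open>
  The category of affine schemes over the complex numbers is the opposite of the category of
  commutative algebras, and closed embeddings correspond to surjections. An affine ind-scheme
  \<open>\<X> 0 \<subseteq> \<X> 1 \<subseteq> \<dots>\<close> is therefore given by the coordinate algebras \<open>coord \<X> n\<close> of its pieces and the
  restriction maps \<open>res \<X> n\<close> from \<open>coord \<X> (Suc n)\<close> onto \<open>coord \<X> n\<close>.
\<close>

record 'a ind_scheme =
  coord :: "nat \<Rightarrow> 'a calg"
  res :: "nat \<Rightarrow> 'a \<Rightarrow> 'a"

definition affine_ind_scheme :: "'a ind_scheme \<Rightarrow> bool"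
  where "affine_ind_scheme \<X> \<longleftrightarrow> (\<forall>n.
    algebra complex_ring (coord \<X> n) \<and>
    res \<X> n \<in> calg_hom (coord \<X> (Suc n)) (coord \<X> n) \<and>
    res \<X> n ` carrier (coord \<X> (Suc n)) = carrier (coord \<X> n))"

text \<open>For \<open>m \<le> n\<close>, the composite restriction map from \<open>coord \<X> n\<close> to \<open>coord \<X> m\<close>:\<close>

primrec restr :: "'a ind_scheme \<Rightarrow> nat \<Rightarrow> nat \<Rightarrow> 'a \<Rightarrow> 'a"
  where
    "restr \<X> m 0 = (\<lambda>a. a)"
  | "restr \<X> m (Suc n) = (if m \<le> n then restr \<X> m n \<circ> res \<X> n else (\<lambda>a. a))"

text \<open>
  Morphisms from \<open>\<X>\<close> to \<open>\<Y>\<close> are the elements of \<open>lim\<^sub>k colim\<^sub>m Hom(\<X> k, \<Y> m)\<close>, that is, of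
  \<open>lim\<^sub>k colim\<^sub>m Hom(coord \<Y> m, coord \<X> k)\<close>. Such an element is represented by choosing, for
  every \<open>k\<close>, a level \<open>lvl f k\<close> of \<open>\<Y>\<close> and a comorphism from \<open>coord \<Y> (lvl f k)\<close> to \<open>coord \<X> k\<close>.
  The relation \<open>colim_eq \<Y> m \<phi> m' \<psi>\<close> is equality in the colimit over the levels of \<open>\<Y>\<close>.
\<close>

record ('a, 'b) ind_mor =
  lvl :: "nat \<Rightarrow> nat"
  comor :: "nat \<Rightarrow> 'b \<Rightarrow> 'a"

definition colim_eq :: "'b ind_scheme \<Rightarrow> nat \<Rightarrow> ('b \<Rightarrow> 'a) \<Rightarrow> nat \<Rightarrow> ('b \<Rightarrow> 'a) \<Rightarrow> bool"
  where "colim_eq \<Y> m \<phi> m' \<psi> \<longleftrightarrow> (\<exists>n. m \<le> n \<and> m' \<le> n \<and>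
    (\<forall>b\<in>carrier (coord \<Y> n). \<phi> (restr \<Y> m n b) = \<psi> (restr \<Y> m' n b)))"

definition ind_morphism :: "'a ind_scheme \<Rightarrow> 'b ind_scheme \<Rightarrow> ('a, 'b) ind_mor \<Rightarrow> bool"
  where "ind_morphism \<X> \<Y> f \<longleftrightarrow> (\<forall>k.
    comor f k \<in> calg_hom (coord \<Y> (lvl f k)) (coord \<X> k) \<and>
    colim_eq \<Y> (lvl f (Suc k)) (res \<X> k \<circ> comor f (Suc k)) (lvl f k) (comor f k))"

definition ind_mor_eq :: "'b ind_scheme \<Rightarrow> ('a, 'b) ind_mor \<Rightarrow> ('a, 'b) ind_mor \<Rightarrow> bool"
  where "ind_mor_eq \<Y> f g \<longleftrightarrow> (\<forall>k. colim_eq \<Y> (lvl f k) (comor f k) (lvl g k) (comor g k))"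

definition ind_id :: "('a, 'a) ind_mor"
  where "ind_id = \<lparr>lvl = (\<lambda>k. k), comor = (\<lambda>k a. a)\<rparr>"

definition ind_comp :: "('b, 'c) ind_mor \<Rightarrow> ('a, 'b) ind_mor \<Rightarrow> ('a, 'c) ind_mor"
  where "ind_comp g f =
    \<lparr>lvl = (\<lambda>k. lvl g (lvl f k)), comor = (\<lambda>k. comor f k \<circ> comor g (lvl f k))\<rparr>"

definition ind_isomorphism :: "'a ind_scheme \<Rightarrow> 'b ind_scheme \<Rightarrow> ('a, 'b) ind_mor \<Rightarrow> bool"
  where "ind_isomorphism \<X> \<Y> f \<longleftrightarrow> ind_morphism \<X> \<Y> f \<and>
    (\<exists>g. ind_morphism \<Y> \<X> g \<and>
         ind_mor_eq \<X> (ind_comp g f) ind_id \<and> ind_mor_eq \<Y> (ind_comp f g) ind_id)"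

section \<open>Coordinate algebras of affine spaces\<close>

text \<open>
  The polynomial functions on a set \<open>V\<close> in the coordinate functions \<open>L\<close>. As the ground field is
  infinite, on a finite-dimensional space these form the polynomial ring in the nonzero
  coordinates. Functions on \<open>V\<close> are \<^const>\<open>undefined\<close> outside \<open>V\<close>.
\<close>

inductive_set poly_fun :: "'v set \<Rightarrow> ('v \<Rightarrow> complex) set \<Rightarrow> ('v \<Rightarrow> complex) set"
  for V :: "'v set" and L :: "('v \<Rightarrow> complex) set"
  where
    const: "(\<lambda>v\<in>V. c) \<in> poly_fun V L"
  | coordinate: "l \<in> L \<Longrightarrow> restrict l V \<in> poly_fun V L"
  | add: "f \<in> poly_fun V L \<Longrightarrow> g \<in> poly_fun V L \<Longrightarrow> (\<lambda>v\<in>V. f v + g v) \<in> poly_fun V L"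
  | mult: "f \<in> poly_fun V L \<Longrightarrow> g \<in> poly_fun V L \<Longrightarrow> (\<lambda>v\<in>V. f v * g v) \<in> poly_fun V L"

definition fun_alg :: "'v set \<Rightarrow> ('v \<Rightarrow> complex) set \<Rightarrow> ('v \<Rightarrow> complex) calg"
  where "fun_alg V L =
    \<lparr>carrier = poly_fun V L,
     monoid.mult = (\<lambda>f g. \<lambda>v\<in>V. f v * g v), one = (\<lambda>v\<in>V. 1),
     ring.zero = (\<lambda>v\<in>V. 0), add = (\<lambda>f g. \<lambda>v\<in>V. f v + g v),
     module.smult = (\<lambda>c f. \<lambda>v\<in>V. c * f v)\<rparr>"

text \<open>
  The ind-scheme whose \<open>n\<close>-th piece is the closed subscheme of the affine space \<open>V n\<close> cut out by
  the ideal \<open>J n\<close>. The restriction map sends the class of \<open>f\<close> to the class of \<open>f\<close> restricted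
  to \<open>V n\<close>.
\<close>

definition closed_ind_scheme ::
    "(nat \<Rightarrow> 'v set) \<Rightarrow> ('v \<Rightarrow> complex) set \<Rightarrow> (nat \<Rightarrow> ('v \<Rightarrow> complex) set) \<Rightarrow>
      ('v \<Rightarrow> complex) set ind_scheme"
  where "closed_ind_scheme V L J =
    \<lparr>coord = (\<lambda>n. quot_calg (fun_alg (V n) L) (J n)),
     res = (\<lambda>n S. \<Union>f\<in>S. J n +>\<^bsub>fun_alg (V n) L\<^esub> restrict f (V n))\<rparr>"

section \<open>The free algebra on two generators\<close>

text \<open>
  \<open>ncword\<close> is the free monoid on two letters, written additively because the convolution product
  on \<^type>\<open>poly_mapping\<close> is the monoid algebra of an additive monoid.
\<close>

datatype letter = LX | LY

datatype ncword = Word (letters: "letter list")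

instantiation ncword :: monoid_add
begin

definition zero_ncword :: ncword where "0 = Word []"

definition plus_ncword :: "ncword \<Rightarrow> ncword \<Rightarrow> ncword"
  where "u + v = Word (letters u @ letters v)"

instance
  by standard (auto simp: zero_ncword_def plus_ncword_def)

end

type_synonym free_alg = "ncword \<Rightarrow>\<^sub>0 complex"

definition gen_x :: free_alg where "gen_x = Poly_Mapping.single (Word [LX]) 1"

definition gen_y :: free_alg where "gen_y = Poly_Mapping.single (Word [LY]) 1"

definition scal :: "complex \<Rightarrow> free_alg \<Rightarrow> free_alg"
  where "scal c p = Poly_Mapping.single 0 c * p"

definition R_le :: "nat \<Rightarrow> free_alg set"
  where "R_le k = {p. \<forall>u\<in>Poly_Mapping.keys p. length (letters u) \<le> k}"

definition R_coords :: "(free_alg \<Rightarrow> complex) set"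
  where "R_coords = range (\<lambda>u p. Poly_Mapping.lookup p u)"

definition E_le :: "nat \<Rightarrow> (free_alg \<times> free_alg) set"
  where "E_le k = R_le k \<times> R_le k"

definition E_coords :: "(free_alg \<times> free_alg \<Rightarrow> complex) set"
  where "E_coords = range (\<lambda>u e. Poly_Mapping.lookup (fst e) u)
    \<union> range (\<lambda>u e. Poly_Mapping.lookup (snd e) u)"

definition comm :: "free_alg \<times> free_alg \<Rightarrow> free_alg"
  where "comm e = fst e * snd e - snd e * fst e"

definition w :: free_alg
  where "w = gen_x * gen_y - gen_y * gen_x"

definition alg_automorphism :: "(free_alg \<Rightarrow> free_alg) \<Rightarrow> bool"
  where "alg_automorphism \<sigma> \<longleftrightarrow> bij \<sigma> \<and> \<sigma> 1 = 1 \<and>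
    (\<forall>p q. \<sigma> (p + q) = \<sigma> p + \<sigma> q) \<and> (\<forall>p q. \<sigma> (p * q) = \<sigma> p * \<sigma> q) \<and>
    (\<forall>c p. \<sigma> (scal c p) = scal c (\<sigma> p))"

text \<open>The group \<open>G\<close>, as a subset of \<open>E\<close> via \<open>\<sigma> \<mapsto> (\<sigma>(x), \<sigma>(y))\<close>:\<close>

definition G :: "(free_alg \<times> free_alg) set"
  where "G = {(\<sigma> gen_x, \<sigma> gen_y) |\<sigma>. alg_automorphism \<sigma> \<and> \<sigma> w = w}"

section \<open>The ind-variety and the ind-scheme structure\<close>

abbreviation CE :: "nat \<Rightarrow> (free_alg \<times> free_alg \<Rightarrow> complex) calg"
  where "CE k \<equiv> fun_alg (E_le k) E_coords"

abbreviation CR :: "nat \<Rightarrow> (free_alg \<Rightarrow> complex) calg"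
  where "CR k \<equiv> fun_alg (R_le k) R_coords"

text \<open>
  The vanishing ideal of \<open>G \<inter> E_le k\<close>. By a theorem of Dicks an endomorphism fixing \<open>w\<close> is an
  automorphism, so by the Nullstellensatz this is the radical of \<open>fibre_ideal k\<close> below for \<open>k \<ge> 1\<close>.
\<close>

definition reduced_ideal :: "nat \<Rightarrow> (free_alg \<times> free_alg \<Rightarrow> complex) set"
  where "reduced_ideal k = {f \<in> carrier (CE k). \<forall>e\<in>G \<inter> E_le k. f e = 0}"

definition max_ideal_w :: "nat \<Rightarrow> (free_alg \<Rightarrow> complex) set"
  where "max_ideal_w k = {f \<in> carrier (CR k). f w = 0}"

definition comm_pullback ::
    "nat \<Rightarrow> (free_alg \<Rightarrow> complex) \<Rightarrow> (free_alg \<times> free_alg \<Rightarrow> complex)"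
  where "comm_pullback k f = (\<lambda>e\<in>E_le k. f (comm e))"

definition fibre_ideal :: "nat \<Rightarrow> (free_alg \<times> free_alg \<Rightarrow> complex) set"
  where "fibre_ideal k = Idl\<^bsub>CE k\<^esub> (comm_pullback k ` max_ideal_w (2 * k))"

text \<open>
  The filtrations are indexed by \<open>k \<ge> 1\<close>: for \<open>k = 0\<close> the target of \<open>c\<^sub>k\<close> does not contain \<open>w\<close>.
\<close>

definition G_ind :: "(free_alg \<times> free_alg \<Rightarrow> complex) set ind_scheme"
  where "G_ind = closed_ind_scheme (\<lambda>n. E_le (Suc n)) E_coords (\<lambda>n. reduced_ideal (Suc n))"

definition GG_ind :: "(free_alg \<times> free_alg \<Rightarrow> complex) set ind_scheme"
  where "GG_ind = closed_ind_scheme (\<lambda>n. E_le (Suc n)) E_coords (\<lambda>n. fibre_ideal (Suc n))"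

text \<open>
  As the reduced ideal contains the fibre ideal, adding it to a coset \<open>fibre_ideal + f\<close>
  yields the coset \<open>reduced_ideal + f\<close>.
\<close>

definition can_mor ::
    "((free_alg \<times> free_alg \<Rightarrow> complex) set, (free_alg \<times> free_alg \<Rightarrow> complex) set) ind_mor"
  where "can_mor = \<lparr>lvl = (\<lambda>n. n),
    comor = (\<lambda>n S. reduced_ideal (Suc n) <+>\<^bsub>CE (Suc n)\<^esub> S)\<rparr>"

section \<open>Well-definedness\<close>

lemma poly_fun_ext: "f \<in> poly_fun V L \<Longrightarrow> f \<in> extensional V"
  by (induction rule: poly_fun.induct) (simp_all del: restrict_apply)

lemma fun_alg_simps [simp]:
  "carrier (fun_alg V L) = poly_fun V L"
  "f \<otimes>\<^bsub>fun_alg V L\<^esub> g = (\<lambda>v\<in>V. f v * g v)"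
  "f \<oplus>\<^bsub>fun_alg V L\<^esub> g = (\<lambda>v\<in>V. f v + g v)"
  "\<one>\<^bsub>fun_alg V L\<^esub> = (\<lambda>v\<in>V. 1)"
  "\<zero>\<^bsub>fun_alg V L\<^esub> = (\<lambda>v\<in>V. 0)"
  "c \<odot>\<^bsub>fun_alg V L\<^esub> f = (\<lambda>v\<in>V. c * f v)"
  by (simp_all add: fun_alg_def)

lemma poly_fun_smult: "f \<in> poly_fun V L \<Longrightarrow> (\<lambda>v\<in>V. c * f v) \<in> poly_fun V L"
proof -
  assume f: "f \<in> poly_fun V L"
  have "(\<lambda>v\<in>V. (\<lambda>v\<in>V. c) v * f v) = (\<lambda>v\<in>V. c * f v)"
    by (rule restrict_ext) simp
  with poly_fun.mult[OF poly_fun.const f, of c] show ?thesis by simp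
qed

lemma restrict_id_poly: "f \<in> poly_fun V L \<Longrightarrow> restrict f V = f"
  using poly_fun_ext extensional_restrict by blast

lemma fun_alg_cring: "cring (fun_alg V L)"
proof (rule cringI)
  show "abelian_group (fun_alg V L)"
  proof (rule abelian_groupI, goal_cases)
    case (6 f)
    then show ?case
      using poly_fun_smult[of f V L "- 1"]
      by (intro bexI[of _ "\<lambda>v\<in>V. (-1) * f v"]) (auto cong: restrict_cong)
  qed (auto intro: poly_fun.intros simp: algebra_simps restrict_id_poly cong: restrict_cong)
  show "Group.comm_monoid (fun_alg V L)"
    by (rule comm_monoidI)
      (auto intro: poly_fun.intros simp: algebra_simps restrict_id_poly cong: restrict_cong)
qed (auto simp: algebra_simps cong: restrict_cong)

lemma fun_alg_algebra: "algebra complex_ring (fun_alg V L)"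
proof (rule algebraI)
  show "cring complex_ring" by (rule cring_from_type_algebra)
qed (auto simp: fun_alg_cring poly_fun_smult ring_of_type_algebra_def algebra_simps
    restrict_id_poly cong: restrict_cong)

lemma quot_calg_sel:
  "carrier (quot_calg A J) = carrier (A Quot J)"
  "monoid.mult (quot_calg A J) = monoid.mult (A Quot J)"
  "one (quot_calg A J) = one (A Quot J)"
  "ring.zero (quot_calg A J) = ring.zero (A Quot J)"
  "add (quot_calg A J) = add (A Quot J)"
  "module.smult (quot_calg A J) = (\<lambda>c S. \<Union>a\<in>S. J +>\<^bsub>A\<^esub> (c \<odot>\<^bsub>A\<^esub> a))"
  by (simp_all add: quot_calg_def ring.defs module.defs)

lemma carrier_quot: "carrier (quot_calg A J) = (\<lambda>a. J +>\<^bsub>A\<^esub> a) ` carrier A"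
  by (auto simp: quot_calg_sel FactRing_simps)

lemma cring_quot_calg:
  assumes "cring A" "ideal J A"
  shows "cring (quot_calg A J)"
proof -
  have "cring (A Quot J)"
    using assms by (simp add: ideal.quotient_is_cring)
  then interpret Q: cring "A Quot J" .
  show ?thesis
  proof (rule cringI)
    show "abelian_group (quot_calg A J)"
    proof (rule abelian_groupI, goal_cases)
      case (6 x)
      then show ?case
        using Q.l_neg Q.a_inv_closed unfolding quot_calg_sel by blast
    qed (simp_all add: quot_calg_sel Q.a_ac)
    show "Group.comm_monoid (quot_calg A J)"
      by (rule comm_monoidI) (simp_all add: quot_calg_sel Q.m_ac)
  qed (simp add: quot_calg_sel Q.l_distr)
qed

lemma coset_UN:
  assumes "ideal J A" "a \<in> carrier A" "\<And>b. b \<in> J +>\<^bsub>A\<^esub> a \<Longrightarrow> F b = F a"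
  shows "(\<Union>b\<in>J +>\<^bsub>A\<^esub> a. F b) = F a"
proof -
  interpret ideal J A by fact
  show ?thesis
    using assms a_rcos_self by blast
qed

lemma quot_smult:
  assumes "algebra complex_ring A" "ideal J A" "a \<in> carrier A"
  shows "c \<odot>\<^bsub>quot_calg A J\<^esub> (J +>\<^bsub>A\<^esub> a) = J +>\<^bsub>A\<^esub> (c \<odot>\<^bsub>A\<^esub> a)"
proof -
  interpret M: algebra complex_ring A by fact
  interpret ideal J A by fact
  have C: "c \<in> carrier complex_ring" by (simp add: ring_of_type_algebra_def)
  have "J +>\<^bsub>A\<^esub> (c \<odot>\<^bsub>A\<^esub> b) = J +>\<^bsub>A\<^esub> (c \<odot>\<^bsub>A\<^esub> a)" if b: "b \<in> J +>\<^bsub>A\<^esub> a" for b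
  proof -
    obtain j where j: "j \<in> J" "b = j \<oplus>\<^bsub>A\<^esub> a"
      using b by (auto simp: a_r_coset_def r_coset_def)
    have jA: "j \<in> carrier A" using j a_Hcarr by blast
    have "c \<odot>\<^bsub>A\<^esub> j = (c \<odot>\<^bsub>A\<^esub> \<one>\<^bsub>A\<^esub>) \<otimes>\<^bsub>A\<^esub> j"
      using C jA by (simp add: M.smult_assoc2)
    then have cj: "c \<odot>\<^bsub>A\<^esub> j \<in> J"
      using C jA j I_l_closed by simp
    have "c \<odot>\<^bsub>A\<^esub> b = c \<odot>\<^bsub>A\<^esub> j \<oplus>\<^bsub>A\<^esub> c \<odot>\<^bsub>A\<^esub> a"
      using C jA j assms(3) by (simp add: M.smult_r_distr)
    then have "c \<odot>\<^bsub>A\<^esub> b \<in> J +>\<^bsub>A\<^esub> (c \<odot>\<^bsub>A\<^esub> a)"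
      using cj by (auto simp: a_r_coset_def r_coset_def)
    then show ?thesis
      using C assms(3) by (metis M.smult_closed a_repr_independence')
  qed
  then show ?thesis
    unfolding quot_calg_sel using coset_UN[OF assms(2,3), of "\<lambda>b. J +>\<^bsub>A\<^esub> (c \<odot>\<^bsub>A\<^esub> b)"]
    by simp
qed

lemma quot_mult:
  assumes "ideal J A" "a \<in> carrier A" "b \<in> carrier A"
  shows "(J +>\<^bsub>A\<^esub> a) \<otimes>\<^bsub>quot_calg A J\<^esub> (J +>\<^bsub>A\<^esub> b) = J +>\<^bsub>A\<^esub> (a \<otimes>\<^bsub>A\<^esub> b)"
  using ideal.rcoset_mult_add[OF assms] by (simp add: quot_calg_sel FactRing_def)

lemma quot_add:
  assumes "ideal J A" "a \<in> carrier A" "b \<in> carrier A"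
  shows "(J +>\<^bsub>A\<^esub> a) \<oplus>\<^bsub>quot_calg A J\<^esub> (J +>\<^bsub>A\<^esub> b) = J +>\<^bsub>A\<^esub> (a \<oplus>\<^bsub>A\<^esub> b)"
  using ideal.a_rcos_sum[OF assms] by (simp add: quot_calg_sel FactRing_def)

lemma quot_one: "\<one>\<^bsub>quot_calg A J\<^esub> = J +>\<^bsub>A\<^esub> \<one>\<^bsub>A\<^esub>"
  by (simp add: quot_calg_sel FactRing_def)

lemma quot_algebra:
  assumes A: "algebra complex_ring A" and J: "ideal J A"
  shows "algebra complex_ring (quot_calg A J)"
proof -
  interpret M: algebra complex_ring A by fact
  have C: "c \<in> carrier complex_ring" for c by (simp add: ring_of_type_algebra_def)
  show ?thesis
  proof (rule algebraI)
    show "cring (quot_calg A J)" by (intro cring_quot_calg M.M_cring J)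
  qed (auto simp: M.R_cring carrier_quot quot_smult[OF A J] quot_mult[OF J] quot_add[OF J]
      C M.smult_l_distr M.smult_r_distr M.smult_assoc1 M.smult_assoc2)
qed

lemma induced_apply:
  assumes h: "h \<in> calg_hom A B" and I: "ideal I A" and J: "ideal J B"
    and sub: "h ` I \<subseteq> J" and a: "a \<in> carrier A"
  shows "(\<Union>f\<in>I +>\<^bsub>A\<^esub> a. J +>\<^bsub>B\<^esub> h f) = J +>\<^bsub>B\<^esub> h a"
proof (rule coset_UN[OF I a])
  fix b assume "b \<in> I +>\<^bsub>A\<^esub> a"
  interpret I: ideal I A by fact
  interpret J: ideal J B by fact
  have hr: "h \<in> ring_hom A B" using h by (simp add: calg_hom_def)
  obtain j where j: "j \<in> I" "b = j \<oplus>\<^bsub>A\<^esub> a"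
    using \<open>b \<in> _\<close> by (auto simp: a_r_coset_def r_coset_def)
  have "j \<in> carrier A" using j I.a_Hcarr by blast
  then have "h b = h j \<oplus>\<^bsub>B\<^esub> h a"
    using j a ring_hom_add[OF hr] by simp
  then have "h b \<in> J +>\<^bsub>B\<^esub> h a"
    using sub j by (auto simp: a_r_coset_def r_coset_def)
  then show "J +>\<^bsub>B\<^esub> h b = J +>\<^bsub>B\<^esub> h a"
    using J.a_repr_independence' ring_hom_closed[OF hr a] by metis
qed

lemma induced_hom:
  assumes A: "algebra complex_ring A" and B: "algebra complex_ring B"
    and h: "h \<in> calg_hom A B" and I: "ideal I A" and J: "ideal J B" and sub: "h ` I \<subseteq> J"
  shows "(\<lambda>S. \<Union>f\<in>S. J +>\<^bsub>B\<^esub> h f) \<in> calg_hom (quot_calg A I) (quot_calg B J)"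
proof -
  interpret MA: algebra complex_ring A by fact
  interpret MB: algebra complex_ring B by fact
  have C: "c \<in> carrier complex_ring" for c by (simp add: ring_of_type_algebra_def)
  note ind = induced_apply[OF h I J sub]
  have hr: "h \<in> ring_hom A B" and hs: "\<And>c a. a \<in> carrier A \<Longrightarrow> h (c \<odot>\<^bsub>A\<^esub> a) = c \<odot>\<^bsub>B\<^esub> h a"
    using h by (simp_all add: calg_hom_def)
  note hh = ring_hom_closed[OF hr] ring_hom_add[OF hr] ring_hom_mult[OF hr] ring_hom_one[OF hr]
  have "(\<lambda>S. \<Union>f\<in>S. J +>\<^bsub>B\<^esub> h f) \<in> ring_hom (quot_calg A I) (quot_calg B J)"
    using MA.m_closed MA.M.add.m_closed MA.one_closed
    by (intro ring_hom_memI; (unfold carrier_quot)?; (elim imageE)?)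
      (simp_all only: ind hh quot_mult[OF I] quot_mult[OF J] quot_add[OF I]
        quot_add[OF J] quot_one image_eqI)
  then show ?thesis
    by (auto simp: calg_hom_def carrier_quot quot_smult[OF A I] quot_smult[OF B J] ind hs hh C)
qed

lemma restrict_poly_fun:
  "f \<in> poly_fun V' L \<Longrightarrow> V \<subseteq> V' \<Longrightarrow> restrict f V \<in> poly_fun V L"
proof (induction rule: poly_fun.induct)
  case (const c)
  then have "restrict (\<lambda>v\<in>V'. c) V = (\<lambda>v\<in>V. c)" by (auto simp: restrict_def fun_eq_iff)
  then show ?case by (simp only: poly_fun.const)
next
  case (coordinate l)
  then have "restrict (restrict l V') V = restrict l V" by (auto simp: restrict_def fun_eq_iff)
  then show ?case using coordinate by (simp only: poly_fun.coordinate)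
next
  case (add f g)
  then have "restrict (\<lambda>v\<in>V'. f v + g v) V = (\<lambda>v\<in>V. restrict f V v + restrict g V v)"
    by (auto simp: restrict_def fun_eq_iff)
  then show ?case using add by (simp only: poly_fun.add)
next
  case (mult f g)
  then have "restrict (\<lambda>v\<in>V'. f v * g v) V = (\<lambda>v\<in>V. restrict f V v * restrict g V v)"
    by (auto simp: restrict_def fun_eq_iff)
  then show ?case using mult by (simp only: poly_fun.mult)
qed

lemma restrict_hom:
  assumes "V \<subseteq> V'"
  shows "(\<lambda>f. restrict f V) \<in> calg_hom (fun_alg V' L) (fun_alg V L)"
  using restrict_poly_fun[OF _ assms] assms unfolding calg_hom_def
  by (auto intro!: ring_hom_memI simp: fun_eq_iff)

lemma restrict_surj:
  assumes "V \<subseteq> V'" "g \<in> poly_fun V L"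
  shows "\<exists>f\<in>poly_fun V' L. restrict f V = g"
  using assms(2)
proof (induction rule: poly_fun.induct)
  case (const c)
  show ?case
    by (intro bexI[OF _ poly_fun.const[where c = c]]) (use assms in \<open>auto simp: restrict_def fun_eq_iff\<close>)
next
  case (coordinate l)
  show ?case
    by (intro bexI[OF _ poly_fun.coordinate[OF coordinate]])
      (use assms in \<open>auto simp: restrict_def fun_eq_iff\<close>)
next
  case (add f g)
  then obtain f' g' where *: "f' \<in> poly_fun V' L" "g' \<in> poly_fun V' L"
    "restrict f' V = f" "restrict g' V = g" by blast
  show ?case
    unfolding *(3,4)[symmetric]
    by (intro bexI[OF _ poly_fun.add[OF *(1,2)]])
      (use assms in \<open>auto simp: fun_eq_iff\<close>)
next
  case (mult f g)
  then obtain f' g' where *: "f' \<in> poly_fun V' L" "g' \<in> poly_fun V' L"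
    "restrict f' V = f" "restrict g' V = g" by blast
  show ?case
    unfolding *(3,4)[symmetric]
    by (intro bexI[OF _ poly_fun.mult[OF *(1,2)]])
      (use assms in \<open>auto simp: fun_eq_iff\<close>)
qed

lemma closed_ind_scheme_affine:
  assumes V: "\<And>n. V n \<subseteq> V (Suc n)"
    and J: "\<And>n. ideal (J n) (fun_alg (V n) L)"
    and JJ: "\<And>n. (\<lambda>f. restrict f (V n)) ` J (Suc n) \<subseteq> J n"
  shows "affine_ind_scheme (closed_ind_scheme V L J)"
  unfolding affine_ind_scheme_def
proof (intro allI conjI)
  fix n
  show "algebra complex_ring (coord (closed_ind_scheme V L J) n)"
    by (simp add: closed_ind_scheme_def quot_algebra fun_alg_algebra J)
  show "res (closed_ind_scheme V L J) n
      \<in> calg_hom (coord (closed_ind_scheme V L J) (Suc n)) (coord (closed_ind_scheme V L J) n)"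
    unfolding closed_ind_scheme_def ind_scheme.simps
    by (rule induced_hom[OF fun_alg_algebra fun_alg_algebra restrict_hom[OF V] J J JJ])
  show "res (closed_ind_scheme V L J) n ` carrier (coord (closed_ind_scheme V L J) (Suc n))
      = carrier (coord (closed_ind_scheme V L J) n)"
    unfolding closed_ind_scheme_def ind_scheme.simps carrier_quot image_image
    using restrict_surj[OF V] restrict_poly_fun[OF _ V]
    by (fastforce simp: induced_apply[OF restrict_hom[OF V] J J JJ] image_iff)
qed

lemma closed_ind_scheme_incl:
  assumes V: "\<And>n. V n \<subseteq> V (Suc n)"
    and I: "\<And>n. ideal (I n) (fun_alg (V n) L)" and J: "\<And>n. ideal (J n) (fun_alg (V n) L)"
    and II: "\<And>n. (\<lambda>f. restrict f (V n)) ` I (Suc n) \<subseteq> I n"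
    and JJ: "\<And>n. (\<lambda>f. restrict f (V n)) ` J (Suc n) \<subseteq> J n"
    and JI: "\<And>n. J n \<subseteq> I n"
  shows "ind_morphism (closed_ind_scheme V L I) (closed_ind_scheme V L J)
    \<lparr>lvl = (\<lambda>n. n), comor = (\<lambda>n S. I n <+>\<^bsub>fun_alg (V n) L\<^esub> S)\<rparr>"
proof -
  have add_eq: "(\<lambda>S. K <+>\<^bsub>A\<^esub> S) = (\<lambda>S. \<Union>f\<in>S. K +>\<^bsub>A\<^esub> (\<lambda>f. f) f)"
    for K :: "('v \<Rightarrow> complex) set" and A :: "('v \<Rightarrow> complex) calg"
    by (auto simp: fun_eq_iff set_add_def set_mult_def a_r_coset_def r_coset_def)
  have idh: "(\<lambda>f. f) \<in> calg_hom A A" for A :: "('v \<Rightarrow> complex) calg"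
    by (auto simp: calg_hom_def intro!: ring_hom_memI)
  have JI': "(\<lambda>f. f) ` J n \<subseteq> I n" for n using JI by auto
  note hom = induced_hom[OF fun_alg_algebra fun_alg_algebra idh J I JI']
  note app = induced_apply[OF idh J I JI']
  note rI = induced_apply[OF restrict_hom[OF V] I I II]
  note rJ = induced_apply[OF restrict_hom[OF V] J J JJ]
  show ?thesis
    unfolding ind_morphism_def
  proof (intro allI conjI)
    fix k
    show "colim_eq (closed_ind_scheme V L J)
      (lvl \<lparr>lvl = (\<lambda>n. n), comor = (\<lambda>n S. I n <+>\<^bsub>fun_alg (V n) L\<^esub> S)\<rparr> (Suc k))
      (res (closed_ind_scheme V L I) k \<circ>
        comor \<lparr>lvl = (\<lambda>n. n), comor = (\<lambda>n S. I n <+>\<^bsub>fun_alg (V n) L\<^esub> S)\<rparr> (Suc k))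
      (lvl \<lparr>lvl = (\<lambda>n. n), comor = (\<lambda>n S. I n <+>\<^bsub>fun_alg (V n) L\<^esub> S)\<rparr> k)
      (comor \<lparr>lvl = (\<lambda>n. n), comor = (\<lambda>n S. I n <+>\<^bsub>fun_alg (V n) L\<^esub> S)\<rparr> k)"
      unfolding colim_eq_def
    proof (intro exI[of _ "Suc k"] conjI ballI)
      fix b assume "b \<in> carrier (coord (closed_ind_scheme V L J) (Suc k))"
      then obtain f where f: "f \<in> carrier (fun_alg (V (Suc k)) L)"
        "b = J (Suc k) +>\<^bsub>fun_alg (V (Suc k)) L\<^esub> f"
        by (auto simp: closed_ind_scheme_def carrier_quot)
      have f': "restrict f (V k) \<in> carrier (fun_alg (V k) L)"
        using f restrict_poly_fun[OF _ V] by simp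
      have restr_k: "restr (closed_ind_scheme V L J) k k = (\<lambda>a. a)"
        by (cases k) auto
      show "(res (closed_ind_scheme V L I) k \<circ>
        comor \<lparr>lvl = (\<lambda>n. n), comor = (\<lambda>n S. I n <+>\<^bsub>fun_alg (V n) L\<^esub> S)\<rparr> (Suc k))
        (restr (closed_ind_scheme V L J)
          (lvl \<lparr>lvl = (\<lambda>n. n), comor = (\<lambda>n S. I n <+>\<^bsub>fun_alg (V n) L\<^esub> S)\<rparr> (Suc k)) (Suc k) b)
        = comor \<lparr>lvl = (\<lambda>n. n), comor = (\<lambda>n S. I n <+>\<^bsub>fun_alg (V n) L\<^esub> S)\<rparr> k
          (restr (closed_ind_scheme V L J)
            (lvl \<lparr>lvl = (\<lambda>n. n), comor = (\<lambda>n S. I n <+>\<^bsub>fun_alg (V n) L\<^esub> S)\<rparr> k) (Suc k) b)"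
        unfolding add_eq f(2) using app[OF f(1)] app[OF f'] rI[OF f(1)] rJ[OF f(1)]
        by (simp add: closed_ind_scheme_def restr_k[unfolded closed_ind_scheme_def])
    qed auto
  qed (use hom in \<open>simp add: add_eq closed_ind_scheme_def\<close>)
qed

lemma lookup_mult_ncword:
  fixes p q :: free_alg
  shows "Poly_Mapping.lookup (p * q) u =
    (\<Sum>i\<le>length (letters u). Poly_Mapping.lookup p (Word (take i (letters u))) *
       Poly_Mapping.lookup q (Word (drop i (letters u))))"
proof -
  define ks where "ks = letters u"
  have u: "u = Word ks" by (simp add: ks_def)
  define pre where "pre = (\<lambda>i. Word (take i ks))"
  have inj: "inj_on pre {..length ks}"
    by (intro inj_onI) (metis atMost_iff length_take min.absorb2 ncword.inject pre_def)
  have inner: "(\<Sum>v. Poly_Mapping.lookup q v when u = pre i + v) = Poly_Mapping.lookup q (Word (drop i ks))"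
    if "i \<le> length ks" for i
  proof -
    have "u = pre i + v \<longleftrightarrow> Word (drop i ks) = v" for v
      by (cases v) (metis append_take_drop_id ncword.inject ncword.sel plus_ncword_def pre_def
          same_append_eq u)
    then show ?thesis by simp
  qed
  have outer: "(\<Sum>v. Poly_Mapping.lookup q v when u = l + v) = 0" if "l \<notin> pre ` {..length ks}" for l
  proof -
    have "u \<noteq> l + v" for v
    proof
      assume "u = l + v"
      then have "ks = letters l @ letters v" by (simp add: u plus_ncword_def)
      then have "l = pre (length (letters l))" "length (letters l) \<le> length ks"
        by (simp_all add: pre_def)
      with that show False by auto
    qed
    then show ?thesis by simp
  qed
  have "Poly_Mapping.lookup (p * q) u =
    (\<Sum>l. Poly_Mapping.lookup p l * (\<Sum>v. Poly_Mapping.lookup q v when u = l + v))"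
    by (rule lookup_mult)
  also have "\<dots> = (\<Sum>l\<in>pre ` {..length ks}.
      Poly_Mapping.lookup p l * (\<Sum>v. Poly_Mapping.lookup q v when u = l + v))"
    by (rule Sum_any.expand_superset) (use outer in auto)
  also have "\<dots> = (\<Sum>i\<le>length ks. Poly_Mapping.lookup p (pre i) * Poly_Mapping.lookup q (Word (drop i ks)))"
    using inj inner by (simp add: sum.reindex)
  finally show ?thesis by (simp add: ks_def pre_def)
qed

lemma R_le_iff:
  "p \<in> R_le k \<longleftrightarrow> (\<forall>u. k < length (letters u) \<longrightarrow> Poly_Mapping.lookup p u = 0)"
  unfolding R_le_def by (auto simp: in_keys_iff not_le[symmetric])

lemma R_le_mult: "p \<in> R_le m \<Longrightarrow> q \<in> R_le n \<Longrightarrow> p * q \<in> R_le (m + n)"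
  unfolding R_le_iff lookup_mult_ncword
proof (intro allI impI sum.neutral ballI)
  fix u i
  assume p: "\<forall>u. m < length (letters u) \<longrightarrow> Poly_Mapping.lookup p u = 0"
    and q: "\<forall>u. n < length (letters u) \<longrightarrow> Poly_Mapping.lookup q u = 0"
    and u: "m + n < length (letters u)" and i: "i \<in> {..length (letters u)}"
  show "Poly_Mapping.lookup p (Word (take i (letters u))) *
      Poly_Mapping.lookup q (Word (drop i (letters u))) = 0"
  proof (cases "m < i")
    case True
    then have "Poly_Mapping.lookup p (Word (take i (letters u))) = 0"
      using p i by simp
    then show ?thesis by simp
  next
    case False
    then have "Poly_Mapping.lookup q (Word (drop i (letters u))) = 0"
      using q u by simp
    then show ?thesis by simp
  qed
qed

lemma R_le_diff: "p \<in> R_le k \<Longrightarrow> q \<in> R_le k \<Longrightarrow> p - q \<in> R_le k"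
  unfolding R_le_iff by (simp add: lookup_minus)

lemma R_le_mono: "m \<le> n \<Longrightarrow> R_le m \<subseteq> R_le n"
  by (auto simp: R_le_def intro: order_trans)

lemma E_le_mono: "m \<le> n \<Longrightarrow> E_le m \<subseteq> E_le n"
  unfolding E_le_def by (intro Sigma_mono R_le_mono)

lemma comm_in_R_le: "e \<in> E_le k \<Longrightarrow> comm e \<in> R_le (2 * k)"
  unfolding comm_def mult_2 by (intro R_le_diff R_le_mult) (auto simp: E_le_def)

lemma w_in_R_le: "1 \<le> k \<Longrightarrow> w \<in> R_le (2 * k)"
proof -
  assume k: "1 \<le> k"
  have x: "gen_x \<in> R_le 1" and y: "gen_y \<in> R_le 1"
    by (simp_all add: R_le_def gen_x_def gen_y_def)
  have "w \<in> R_le (1 + 1)"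
    unfolding w_def by (rule R_le_diff[OF R_le_mult[OF x y] R_le_mult[OF y x]])
  moreover have "R_le (1 + 1) \<subseteq> R_le (2 * k)"
    by (rule R_le_mono) (use k in simp)
  ultimately show ?thesis by blast
qed

lemma poly_fun_sum:
  "finite S \<Longrightarrow> (\<And>i. i \<in> S \<Longrightarrow> (\<lambda>v\<in>V. F i v) \<in> poly_fun V L) \<Longrightarrow>
    (\<lambda>v\<in>V. \<Sum>i\<in>S. F i v) \<in> poly_fun V L"
proof (induction S rule: finite_induct)
  case empty
  then show ?case by (simp only: sum.empty poly_fun.const)
next
  case (insert i S)
  then have "(\<lambda>v\<in>V. (\<lambda>v\<in>V. F i v) v + (\<lambda>v\<in>V. \<Sum>i\<in>S. F i v) v) \<in> poly_fun V L"
    by (intro poly_fun.add) auto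
  moreover have "(\<lambda>v\<in>V. (\<lambda>v\<in>V. F i v) v + (\<lambda>v\<in>V. \<Sum>i\<in>S. F i v) v) =
      (\<lambda>v\<in>V. \<Sum>i\<in>insert i S. F i v)"
    by (rule restrict_ext) (simp add: insert)
  ultimately show ?case by (simp only:)
qed

lemma poly_fun_mult':
  assumes "(\<lambda>v\<in>V. f v) \<in> poly_fun V L" "(\<lambda>v\<in>V. g v) \<in> poly_fun V L"
  shows "(\<lambda>v\<in>V. f v * g v) \<in> poly_fun V L"
proof -
  have "(\<lambda>v\<in>V. (\<lambda>v\<in>V. f v) v * (\<lambda>v\<in>V. g v) v) = (\<lambda>v\<in>V. f v * g v)"
    by (rule restrict_ext) simp
  with poly_fun.mult[OF assms] show ?thesis by simp
qed

lemma poly_fun_diff':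
  assumes "(\<lambda>v\<in>V. f v) \<in> poly_fun V L" "(\<lambda>v\<in>V. g v) \<in> poly_fun V L"
  shows "(\<lambda>v\<in>V. f v - g v) \<in> poly_fun V L"
proof -
  have "(\<lambda>v\<in>V. (\<lambda>v\<in>V. f v) v + (\<lambda>v\<in>V. - 1 * (\<lambda>v\<in>V. g v) v) v) = (\<lambda>v\<in>V. f v - g v)"
    by (rule restrict_ext) simp
  with poly_fun.add[OF assms(1) poly_fun_smult[OF assms(2), of "- 1"]] show ?thesis by simp
qed

lemma poly_fun_E_coord:
  "(\<lambda>e\<in>V. Poly_Mapping.lookup (fst e) u) \<in> poly_fun V E_coords"
  "(\<lambda>e\<in>V. Poly_Mapping.lookup (snd e) u) \<in> poly_fun V E_coords"
  by (rule poly_fun.coordinate; simp add: E_coords_def)+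

lemma comm_pullback_poly_fun:
  "f \<in> poly_fun (R_le (2 * k)) R_coords \<Longrightarrow> comm_pullback k f \<in> poly_fun (E_le k) E_coords"
proof (induction rule: poly_fun.induct)
  case (const c)
  have "comm_pullback k (\<lambda>v\<in>R_le (2 * k). c) = (\<lambda>e\<in>E_le k. c)"
    unfolding comm_pullback_def by (rule restrict_ext) (simp add: comm_in_R_le)
  then show ?case by (simp only: poly_fun.const)
next
  case (coordinate l)
  then obtain u where l: "l = (\<lambda>p. Poly_Mapping.lookup p u)" by (auto simp: R_coords_def)
  have "comm_pullback k (restrict l (R_le (2 * k))) = (\<lambda>e\<in>E_le k. l (comm e))"
    unfolding comm_pullback_def by (rule restrict_ext) (simp add: comm_in_R_le)
  also have "\<dots> \<in> poly_fun (E_le k) E_coords"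
    unfolding l comm_def lookup_minus lookup_mult_ncword
    by (intro poly_fun_diff' poly_fun_sum poly_fun_mult' poly_fun_E_coord) auto
  finally show ?case .
next
  case (add f g)
  have "comm_pullback k (\<lambda>v\<in>R_le (2 * k). f v + g v) =
      (\<lambda>e\<in>E_le k. comm_pullback k f e + comm_pullback k g e)"
    unfolding comm_pullback_def by (rule restrict_ext) (simp add: comm_in_R_le)
  then show ?case using add by (simp only: poly_fun.add)
next
  case (mult f g)
  have "comm_pullback k (\<lambda>v\<in>R_le (2 * k). f v * g v) =
      (\<lambda>e\<in>E_le k. comm_pullback k f e * comm_pullback k g e)"
    unfolding comm_pullback_def by (rule restrict_ext) (simp add: comm_in_R_le)
  then show ?case using mult by (simp only: poly_fun.mult)
qed

lemma fibre_gens_subset: "comm_pullback k ` max_ideal_w (2 * k) \<subseteq> carrier (CE k)"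
  by (auto simp: max_ideal_w_def comm_pullback_poly_fun)

lemma ideal_fibre: "ideal (fibre_ideal k) (CE k)"
proof -
  interpret cring "CE k" by (rule fun_alg_cring)
  show ?thesis
    unfolding fibre_ideal_def by (rule genideal_ideal[OF fibre_gens_subset])
qed

lemma fun_alg_idealI:
  assumes sub: "I \<subseteq> poly_fun V L" and z: "(\<lambda>v\<in>V. 0) \<in> I"
    and a: "\<And>f g. f \<in> I \<Longrightarrow> g \<in> I \<Longrightarrow> (\<lambda>v\<in>V. f v + g v) \<in> I"
    and m: "\<And>f g. f \<in> poly_fun V L \<Longrightarrow> g \<in> I \<Longrightarrow> (\<lambda>v\<in>V. f v * g v) \<in> I"
  shows "ideal I (fun_alg V L)"
proof -
  interpret cring "fun_alg V L" by (rule fun_alg_cring)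
  have neg: "\<ominus>\<^bsub>fun_alg V L\<^esub> f = (\<lambda>v\<in>V. (\<lambda>v\<in>V. - 1) v * f v)" if "f \<in> I" for f
  proof (rule minus_equality)
    show "f \<in> carrier (fun_alg V L)" using sub that by auto
    then show "(\<lambda>v\<in>V. (\<lambda>v\<in>V. - 1) v * f v) \<in> carrier (fun_alg V L)"
      by (auto simp del: restrict_apply intro!: poly_fun.mult poly_fun.const)
  qed (auto simp: fun_eq_iff)
  have neg_in: "\<ominus>\<^bsub>fun_alg V L\<^esub> f \<in> I" if "f \<in> I" for f
    unfolding neg[OF that] by (rule m[OF poly_fun.const that])
  show ?thesis
  proof (rule idealI)
    show "subgroup I (add_monoid (fun_alg V L))"
      by (rule add.subgroupI) (use sub z a neg_in in \<open>auto simp: a_inv_def[symmetric]\<close>)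
    fix g f assume "g \<in> I" "f \<in> carrier (fun_alg V L)"
    then show "f \<otimes>\<^bsub>fun_alg V L\<^esub> g \<in> I" "g \<otimes>\<^bsub>fun_alg V L\<^esub> f \<in> I"
      using m[of f g] by (simp_all add: mult.commute)
  qed (rule ring_axioms)
qed

lemma ideal_reduced: "ideal (reduced_ideal k) (CE k)"
  by (rule fun_alg_idealI) (auto simp: reduced_ideal_def intro: poly_fun.intros)

lemma ideal_vimage:
  assumes h: "h \<in> calg_hom A B" and "cring A" "cring B" and J: "ideal J B"
  shows "ideal {a \<in> carrier A. h a \<in> J} A"
proof -
  interpret A: cring A by fact
  interpret B: cring B by fact
  interpret J: ideal J B by fact
  interpret H: ring_hom_cring A B h
    by (intro ring_hom_cringI ring_hom_ringI2 A.ring_axioms B.ring_axioms assms)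
      (use h in \<open>simp add: calg_hom_def\<close>)
  show ?thesis
  proof (rule idealI)
    show "subgroup {a \<in> carrier A. h a \<in> J} (add_monoid A)"
      by (rule A.add.subgroupI)
        (auto simp: a_inv_def[symmetric] J.zero_closed intro: exI[of _ "\<zero>\<^bsub>A\<^esub>"])
  qed (auto simp: J.I_l_closed J.I_r_closed intro: A.ring_axioms)
qed

lemma restrict_fibre:
  assumes k: "1 \<le> k"
  shows "(\<lambda>f. restrict f (E_le k)) ` fibre_ideal (Suc k) \<subseteq> fibre_ideal k"
proof -
  have E: "E_le k \<subseteq> E_le (Suc k)" by (simp add: E_le_mono)
  have Rk: "R_le (2 * k) \<subseteq> R_le (2 * Suc k)" by (rule R_le_mono) simp
  interpret K: cring "CE k" by (rule fun_alg_cring)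
  interpret S: cring "CE (Suc k)" by (rule fun_alg_cring)
  let ?P = "{f \<in> carrier (CE (Suc k)). restrict f (E_le k) \<in> fibre_ideal k}"
  have "ideal ?P (CE (Suc k))"
    by (rule ideal_vimage[OF restrict_hom[OF E] fun_alg_cring fun_alg_cring ideal_fibre])
  moreover have "comm_pullback (Suc k) ` max_ideal_w (2 * Suc k) \<subseteq> ?P"
  proof clarify
    fix f assume f: "f \<in> max_ideal_w (2 * Suc k)"
    have "restrict f (R_le (2 * k)) \<in> max_ideal_w (2 * k)"
      using f w_in_R_le[OF k] restrict_poly_fun[OF _ Rk] by (simp add: max_ideal_w_def)
    then have "comm_pullback k (restrict f (R_le (2 * k))) \<in> fibre_ideal k"
      unfolding fibre_ideal_def using K.genideal_self[OF fibre_gens_subset] by blast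
    moreover have "comm_pullback k (restrict f (R_le (2 * k))) =
        restrict (comm_pullback (Suc k) f) (E_le k)"
      unfolding comm_pullback_def using E
      by (auto simp: fun_eq_iff comm_in_R_le)
    ultimately show "comm_pullback (Suc k) f \<in> carrier (CE (Suc k)) \<and>
        restrict (comm_pullback (Suc k) f) (E_le k) \<in> fibre_ideal k"
      using f fibre_gens_subset[of "Suc k"] by auto
  qed
  ultimately have "fibre_ideal (Suc k) \<subseteq> ?P"
    unfolding fibre_ideal_def[of "Suc k"] by (rule S.genideal_minimal)
  then show ?thesis by auto
qed

lemma restrict_reduced:
  "(\<lambda>f. restrict f (E_le k)) ` reduced_ideal (Suc k) \<subseteq> reduced_ideal k"
  using E_le_mono[of k "Suc k"]
  by (auto simp: reduced_ideal_def restrict_poly_fun)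

lemma G_comm: "e \<in> G \<Longrightarrow> comm e = w"
proof -
  assume "e \<in> G"
  then obtain \<sigma> where s: "e = (\<sigma> gen_x, \<sigma> gen_y)" "alg_automorphism \<sigma>" "\<sigma> w = w"
    by (auto simp: G_def)
  have add: "\<sigma> (p + q) = \<sigma> p + \<sigma> q" for p q
    using s(2) by (simp add: alg_automorphism_def)
  have "\<sigma> (p - q) = \<sigma> p - \<sigma> q" for p q
    using add[of "p - q" q] by (simp add: algebra_simps)
  then have "\<sigma> w = comm e"
    using s(2) unfolding w_def comm_def s(1) by (simp add: alg_automorphism_def)
  then show ?thesis using s(3) by simp
qed

lemma fibre_subset_reduced: "fibre_ideal k \<subseteq> reduced_ideal k"
proof -
  interpret K: cring "CE k" by (rule fun_alg_cring)
  have "comm_pullback k ` max_ideal_w (2 * k) \<subseteq> reduced_ideal k"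
    using fibre_gens_subset[of k]
    by (auto simp: reduced_ideal_def comm_pullback_def max_ideal_w_def G_comm)
  then show ?thesis
    unfolding fibre_ideal_def by (rule K.genideal_minimal[OF ideal_reduced])
qed

lemma affine_G_ind: "affine_ind_scheme G_ind"
  unfolding G_ind_def
  by (rule closed_ind_scheme_affine) (auto intro: ideal_reduced E_le_mono[THEN subsetD, rotated]
      restrict_reduced[THEN subsetD])

lemma affine_GG_ind: "affine_ind_scheme GG_ind"
  unfolding GG_ind_def
  by (rule closed_ind_scheme_affine) (auto intro: ideal_fibre E_le_mono[THEN subsetD, rotated]
      restrict_fibre[THEN subsetD])

lemma ind_morphism_can_mor: "ind_morphism G_ind GG_ind can_mor"
  unfolding G_ind_def GG_ind_def can_mor_def
  by (rule closed_ind_scheme_incl)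
    (auto intro: ideal_fibre ideal_reduced E_le_mono[THEN subsetD, rotated]
      restrict_fibre[THEN subsetD] restrict_reduced[THEN subsetD]
      fibre_subset_reduced[THEN subsetD])

end

theory Submission
  imports Defs "HOL-Analysis.Determinants" "HOL-Computational_Algebra.Polynomial"
begin

text \<open>
  If \<open>i\<close> were an isomorphism, then there would be a level \<open>n\<close> such that every polynomial
  function on \<open>E_le n\<close> vanishing on \<open>G\<close> restricts to an element of the ideal of the
  scheme-theoretic fibre on \<open>E_le 5\<close> (lemma \<open>closed_ind_scheme_incl_isoD\<close>). Elements of that ideal
  have vanishing derivative in every direction tangent to the fibre, so it is enough to find, on
  each \<open>E_le n\<close>, an equation of \<open>G\<close> whose derivative in one fixed tangent direction at the identity
  is not zero.

  The equations come from the Jacobian matrix. Each \<open>p\<close> in the free algebra \<open>R\<close> is uniquely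
  \<open>p = c + p\<^sub>x x + p\<^sub>y y\<close>, where the scalar \<open>c\<close> is the constant term and \<open>p\<^sub>x\<close>, \<open>p\<^sub>y\<close> are the Fox
  derivatives. For an automorphism \<open>\<sigma>\<close> the matrix of Fox derivatives of \<open>(\<sigma>(x), \<sigma>(y))\<close> is left
  invertible over \<open>R\<close>
  (\<open>automorphism_fox_inverse\<close>). Under the representation \<open>x \<mapsto> t E\<^sub>1\<^sub>2\<close>, \<open>y \<mapsto> t E\<^sub>2\<^sub>1\<close> of \<open>R\<close> by
  matrices of size 2 over \<open>\<complex>[t]\<close> it becomes a matrix of size 4 over \<open>\<complex>[t]\<close> with a left inverse.
  Its determinant is a unit of \<open>\<complex>[t]\<close>, that is, a constant, so the coefficients of its positive
  powers of \<open>t\<close> vanish on \<open>G\<close>. They are polynomial functions of \<open>(\<sigma>(x), \<sigma>(y))\<close>.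

  The tangent direction is the Hamiltonian derivation \<open>(p, q) = (\<partial>H/\<partial>y, -\<partial>H/\<partial>x)\<close>, with cyclic
  derivatives, of the cyclic word \<open>H = xxyxyy\<close>; it satisfies \<open>[p, y] + [x, q] = 0\<close>. To first order
  the determinant changes by the trace of the matrix of Fox derivatives of \<open>(p, q)\<close>, the divergence,
  which on Hamiltonian derivations is given by the necklace cobracket. Here it is not zero at \<open>H\<close>, which is a shortest word in \<open>x\<close> and \<open>y\<close> not
  cyclically equal to its reversal. Indeed the determinant at \<open>(x + s p, y + s q)\<close> is \<open>1 - s t\<^sup>4\<close>, so
  the coefficient of \<open>t\<^sup>4\<close> has derivative \<open>-1\<close>.
\<close>

section \<open>A consequence of being an isomorphism\<close>

lemma restr_closed_ind_scheme:
  assumes V: "\<And>n. V n \<subseteq> V (Suc n)"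
    and J: "\<And>n. ideal (J n) (fun_alg (V n) L)"
    and JJ: "\<And>n. (\<lambda>f. restrict f (V n)) ` J (Suc n) \<subseteq> J n"
    and "m \<le> n" "f \<in> poly_fun (V n) L"
  shows "restr (closed_ind_scheme V L J) m n (J n +>\<^bsub>fun_alg (V n) L\<^esub> f) =
    J m +>\<^bsub>fun_alg (V m) L\<^esub> restrict f (V m)"
  using assms(4,5)
proof (induction n arbitrary: f)
  case 0
  then show ?case by (simp add: restrict_id_poly)
next
  case (Suc n)
  show ?case
  proof (cases "m \<le> n")
    case True
    have "V m \<subseteq> V n" using True V by (rule lift_Suc_mono_le[rotated])
    then have "restrict (restrict f (V n)) (V m) = restrict f (V m)"
      by (auto simp: fun_eq_iff restrict_def)
    moreover have "res (closed_ind_scheme V L J) n (J (Suc n) +>\<^bsub>fun_alg (V (Suc n)) L\<^esub> f) =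
        J n +>\<^bsub>fun_alg (V n) L\<^esub> restrict f (V n)"
      using induced_apply[OF restrict_hom[OF V] J J JJ, of f n] Suc.prems
      by (simp add: closed_ind_scheme_def)
    ultimately show ?thesis
      using Suc.IH[OF True restrict_poly_fun[OF Suc.prems(2) V]] True
      by (simp only: restr.simps if_True o_apply)
  next
    case False
    then have "m = Suc n" using Suc.prems by simp
    then show ?thesis using Suc.prems by (simp add: restrict_id_poly)
  qed
qed

text \<open>
  The inverse of an inclusion \<open>\<X> \<subseteq> \<Y>\<close> sends \<open>\<Y> k\<close> into some \<open>\<X> m\<close>, and its composite with the
  inclusion is the identity as seen in some larger \<open>\<Y> n\<close>. So \<open>\<Y> k\<close> lies in \<open>\<X> m\<close>, and hence in
  \<open>\<X> n\<close>, as a subscheme of \<open>\<Y> n\<close>: a function on \<open>\<Y> n\<close> that vanishes on \<open>\<X> n\<close> vanishes on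
  \<open>\<Y> k\<close>.
\<close>

lemma closed_ind_scheme_incl_isoD:
  assumes V: "\<And>n. V n \<subseteq> V (Suc n)"
    and I: "\<And>n. ideal (I n) (fun_alg (V n) L)" and J: "\<And>n. ideal (J n) (fun_alg (V n) L)"
    and II: "\<And>n. (\<lambda>f. restrict f (V n)) ` I (Suc n) \<subseteq> I n"
    and JJ: "\<And>n. (\<lambda>f. restrict f (V n)) ` J (Suc n) \<subseteq> J n"
    and JI: "\<And>n. J n \<subseteq> I n"
    and iso: "ind_isomorphism (closed_ind_scheme V L I) (closed_ind_scheme V L J)
      \<lparr>lvl = (\<lambda>n. n), comor = (\<lambda>n S. I n <+>\<^bsub>fun_alg (V n) L\<^esub> S)\<rparr>"
  shows "\<exists>n\<ge>k. \<forall>f\<in>I n. restrict f (V k) \<in> J k"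
proof -
  let ?X = "closed_ind_scheme V L I" and ?Y = "closed_ind_scheme V L J"
  obtain g where g: "ind_morphism ?Y ?X g"
    and "ind_mor_eq ?Y (ind_comp \<lparr>lvl = (\<lambda>n. n), comor = (\<lambda>n S. I n <+>\<^bsub>fun_alg (V n) L\<^esub> S)\<rparr> g)
      ind_id"
    using iso unfolding ind_isomorphism_def by blast
  then obtain n where n: "lvl g k \<le> n" "k \<le> n"
    and inv: "\<And>b. b \<in> carrier (coord ?Y n) \<Longrightarrow>
      comor g k (I (lvl g k) <+>\<^bsub>fun_alg (V (lvl g k)) L\<^esub> restr ?Y (lvl g k) n b) = restr ?Y k n b"
    by (auto simp: ind_mor_eq_def colim_eq_def ind_comp_def ind_id_def dest!: spec[of _ k])
  define m where "m = lvl g k"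
  have hom: "comor g k \<in> ring_hom (quot_calg (fun_alg (V m) L) (I m)) (quot_calg (fun_alg (V k) L) (J k))"
    using g by (simp add: ind_morphism_def calg_hom_def closed_ind_scheme_def m_def)
  interpret Im: ideal "I m" "fun_alg (V m) L" by (rule I)
  interpret Jk: ideal "J k" "fun_alg (V k) L" by (rule J)
  have zero: "comor g k (I m) = J k"
    using ring_hom_zero[OF hom] cring_quot_calg[OF fun_alg_cring I] cring_quot_calg[OF fun_alg_cring J]
    by (simp add: quot_calg_sel FactRing_def cring.axioms(1))
  have "restrict f (V k) \<in> J k" if f: "f \<in> I n" for f
  proof -
    interpret In: ideal "I n" "fun_alg (V n) L" by (rule I)
    have fp: "f \<in> poly_fun (V n) L" using f In.a_Hcarr by simp
    have Vm: "V l \<subseteq> V n" if "l \<le> n" for l using that V by (rule lift_Suc_mono_le[rotated])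
    have fm: "restrict f (V m) \<in> I m"
      using n(1)[folded m_def] f fp
    proof (induction n arbitrary: f rule: dec_induct)
      case base
      then show ?case by (simp add: restrict_id_poly)
    next
      case (step n)
      have "V m \<subseteq> V n" using step.hyps(1) V by (rule lift_Suc_mono_le[rotated])
      then have "restrict (restrict f (V n)) (V m) = restrict f (V m)"
        by (auto simp: fun_eq_iff restrict_def)
      moreover have "restrict f (V n) \<in> I n" using II[of n] step.prems(1) by blast
      ultimately show ?case
        using step.IH[of "restrict f (V n)"] restrict_poly_fun[OF step.prems(2) V] by (simp only:)
    qed
    have fmp: "restrict f (V m) \<in> carrier (fun_alg (V m) L)" using fm Im.a_Hcarr by simp
    have fk: "restrict f (V k) \<in> carrier (fun_alg (V k) L)"
      using restrict_poly_fun[OF fp Vm[OF n(2)]] by simp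
    have "I m <+>\<^bsub>fun_alg (V m) L\<^esub> (J m +>\<^bsub>fun_alg (V m) L\<^esub> restrict f (V m)) =
        (\<Union>h\<in>J m +>\<^bsub>fun_alg (V m) L\<^esub> restrict f (V m). I m +>\<^bsub>fun_alg (V m) L\<^esub> h)"
      by (auto simp: set_add_def set_mult_def a_r_coset_def r_coset_def)
    also have "\<dots> = I m +>\<^bsub>fun_alg (V m) L\<^esub> restrict f (V m)"
      by (rule induced_apply[OF _ J I _ fmp]) (use JI in \<open>auto simp: calg_hom_def intro!: ring_hom_memI\<close>)
    also have "\<dots> = I m"
      by (rule Im.a_rcos_const[OF fm])
    finally have "I m <+>\<^bsub>fun_alg (V m) L\<^esub> (J m +>\<^bsub>fun_alg (V m) L\<^esub> restrict f (V m)) = I m" .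
    moreover have "J n +>\<^bsub>fun_alg (V n) L\<^esub> f \<in> carrier (coord ?Y n)"
      using fp by (simp add: closed_ind_scheme_def carrier_quot)
    ultimately have "J k +>\<^bsub>fun_alg (V k) L\<^esub> restrict f (V k) = J k"
      using inv[of "J n +>\<^bsub>fun_alg (V n) L\<^esub> f"] zero n fp
      by (simp add: restr_closed_ind_scheme[where V = V and J = J and L = L, OF V J JJ] m_def)
    then show ?thesis using Jk.a_rcos_self[OF fk] by simp
  qed
  with n(2) show ?thesis by blast
qed

section \<open>Fox derivatives in the free algebra\<close>

lemma lookup_scal: "Poly_Mapping.lookup (scal c p) u = c * Poly_Mapping.lookup p u"
proof (cases "letters u")
  case Nil
  then have "u = Word []" by (metis ncword.collapse)
  then show ?thesis by (simp add: scal_def lookup_mult_ncword lookup_single zero_ncword_def)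
next
  case (Cons a l)
  then have u: "u = Word (a # l)" by (metis ncword.collapse)
  have "(\<Sum>i\<le>length (letters u). Poly_Mapping.lookup (Poly_Mapping.single 0 c) (Word (take i (letters u))) *
       Poly_Mapping.lookup p (Word (drop i (letters u)))) =
    (\<Sum>i\<le>length (letters u). if i = 0 then c * Poly_Mapping.lookup p u else 0)"
    by (rule sum.cong) (auto simp: lookup_single when_def zero_ncword_def Cons simp flip: u)
  then show ?thesis unfolding scal_def lookup_mult_ncword by simp
qed

definition gen :: "letter \<Rightarrow> free_alg" where "gen z = Poly_Mapping.single (Word [z]) 1"

lemma inj_snoc: "inj (\<lambda>u. u + Word [z])"
  by (auto simp: inj_def plus_ncword_def ncword.expand)

text \<open>
  The Fox derivatives are the coefficients in \<open>p = c + fox LX p * x + fox LY p * y\<close>; they are found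
  by deleting the last letter of the words of \<open>p\<close>.
\<close>

definition fox :: "letter \<Rightarrow> free_alg \<Rightarrow> free_alg"
  where "fox z p = Poly_Mapping.map_key (\<lambda>u. u + Word [z]) p"

lemma lookup_fox: "Poly_Mapping.lookup (fox z p) u = Poly_Mapping.lookup p (Word (letters u @ [z]))"
  using map_key.rep_eq[OF inj_snoc[of z], of p] by (simp add: fox_def plus_ncword_def)

lemma fox_add: "fox z (p + q) = fox z p + fox z q"
  by (rule poly_mapping_eqI) (simp add: lookup_fox lookup_add)

lemma fox_scal: "fox z (scal c p) = scal c (fox z p)"
  by (rule poly_mapping_eqI) (simp add: lookup_fox lookup_scal)

lemma fox_const: "fox z (Poly_Mapping.single 0 c) = 0"
  by (rule poly_mapping_eqI) (simp add: lookup_fox lookup_single zero_ncword_def when_def)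

lemma fox_gen: "fox z (gen z') = (if z = z' then 1 else 0)"
proof (rule poly_mapping_eqI)
  fix u
  have "u = 0 \<longleftrightarrow> letters u = []" by (metis ncword.collapse ncword.sel zero_ncword_def)
  then show "Poly_Mapping.lookup (fox z (gen z')) u = Poly_Mapping.lookup (if z = z' then 1 else 0) u"
    by (auto simp: lookup_fox gen_def lookup_single lookup_one when_def)
qed

text \<open>
  In general the product rule has the extra summand \<open>q\<^sub>0 * fox z p\<close>, where the scalar \<open>q\<^sub>0\<close> is the
  constant term of \<open>q\<close>.
\<close>

lemma fox_mult:
  assumes "Poly_Mapping.lookup q 0 = 0"
  shows "fox z (p * q) = p * fox z q"
  using assms
  by (intro poly_mapping_eqI) (simp add: lookup_fox lookup_mult_ncword zero_ncword_def)

section \<open>A two-dimensional representation over the polynomial ring\<close>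

instance letter :: finite
proof
  have "(UNIV :: letter set) = {LX, LY}" using letter.exhaust by blast
  then show "finite (UNIV :: letter set)" by (metis finite.emptyI finite.insertI)
qed

lemma UNIV_letter: "UNIV = {LX, LY}"
  using letter.exhaust by blast

lemma sum_letter: "(\<Sum>z\<in>UNIV. f z) = f LX + f LY" for f :: "letter \<Rightarrow> 'a :: comm_monoid_add"
  unfolding UNIV_letter by simp

fun other :: "letter \<Rightarrow> letter" where "other LX = LY" | "other LY = LX"

text \<open>
  The \<open>(a, b)\<close> entry of the matrix by which a word acts when \<open>x\<close> acts as \<open>t E\<^sub>1\<^sub>2\<close> and \<open>y\<close> as \<open>t E\<^sub>2\<^sub>1\<close>,
  the rows and columns 1 and 2 being called \<^const>\<open>LX\<close> and \<^const>\<open>LY\<close>. In other words, a word is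
  a path in the quiver with an arrow \<open>x\<close> from \<^const>\<open>LX\<close> to \<^const>\<open>LY\<close> and an arrow \<open>y\<close> back.
\<close>

fun path :: "letter list \<Rightarrow> letter \<Rightarrow> letter \<Rightarrow> complex poly"
  where
    "path [] a b = (if a = b then 1 else 0)"
  | "path (z # u) a b = (if z = a then monom 1 1 * path u (other a) b else 0)"

lemma path_append: "path (u @ v) a b = (\<Sum>c\<in>UNIV. path u a c * path v c b)"
proof (induction u arbitrary: a)
  case Nil
  have "(\<Sum>c\<in>UNIV. path [] a c * path v c b) = (\<Sum>c\<in>UNIV. if a = c then path v c b else 0)"
    by (rule sum.cong) auto
  then show ?case by simp
next
  case (Cons z u)
  then show ?case by (simp add: sum_distrib_left mult.assoc)
qed

lemma smult_sum_right: "smult c (sum f S) = (\<Sum>i\<in>S. smult c (f i))"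
  by (induction S rule: infinite_finite_induct) (simp_all add: smult_add_right)

text \<open>Entries are taken one by one because the product of the type of matrices is entrywise.\<close>

definition rho :: "free_alg \<Rightarrow> letter \<Rightarrow> letter \<Rightarrow> complex poly"
  where "rho p a b = (\<Sum>u\<in>Poly_Mapping.keys p. smult (Poly_Mapping.lookup p u) (path (letters u) a b))"

lemma rho_superset:
  assumes "finite S" "Poly_Mapping.keys p \<subseteq> S"
  shows "rho p a b = (\<Sum>u\<in>S. smult (Poly_Mapping.lookup p u) (path (letters u) a b))"
  unfolding rho_def using assms by (intro sum.mono_neutral_left) (auto simp: in_keys_iff)

lemma rho_add: "rho (p + q) a b = rho p a b + rho q a b"
proof -
  let ?S = "Poly_Mapping.keys p \<union> Poly_Mapping.keys q"
  have "finite ?S" by simp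
  moreover have "Poly_Mapping.keys (p + q) \<subseteq> ?S" by (rule keys_add)
  ultimately show ?thesis
    by (simp add: rho_superset[of ?S] lookup_add smult_add_left sum.distrib)
qed

lemma rho_0: "rho 0 a b = 0"
  by (simp add: rho_def)

lemma rho_sum: "rho (sum f S) a b = (\<Sum>i\<in>S. rho (f i) a b)"
  by (induction S rule: infinite_finite_induct) (simp_all add: rho_0 rho_add)

lemma rho_single: "rho (Poly_Mapping.single u c) a b = smult c (path (letters u) a b)"
  by (simp add: rho_def)

lemma rho_scal: "rho (scal c p) a b = smult c (rho p a b)"
proof -
  have "Poly_Mapping.keys (scal c p) \<subseteq> Poly_Mapping.keys p"
    by (auto simp: in_keys_iff lookup_scal)
  then show ?thesis
    by (simp add: rho_superset[of "Poly_Mapping.keys p"] lookup_scal smult_sum_right)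
qed

lemma rho_one: "rho 1 a b = (if a = b then 1 else 0)"
  by (simp add: rho_single zero_ncword_def flip: single_one)

lemma sum_singles: "p = (\<Sum>u\<in>Poly_Mapping.keys p. Poly_Mapping.single u (Poly_Mapping.lookup p u))"
  by (rule poly_mapping_eqI) (simp add: lookup_sum lookup_single when_def in_keys_iff)

lemma rho_mult: "rho (p * q) a b = (\<Sum>c\<in>UNIV. rho p a c * rho q c b)"
proof -
  have "rho (p * q) a b = rho ((\<Sum>u\<in>Poly_Mapping.keys p. Poly_Mapping.single u (Poly_Mapping.lookup p u)) *
      (\<Sum>v\<in>Poly_Mapping.keys q. Poly_Mapping.single v (Poly_Mapping.lookup q v))) a b"
    using sum_singles[of p, symmetric] sum_singles[of q, symmetric] by simp
  also have "\<dots> = (\<Sum>u\<in>Poly_Mapping.keys p. \<Sum>v\<in>Poly_Mapping.keys q.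
      smult (Poly_Mapping.lookup p u * Poly_Mapping.lookup q v) (path (letters u @ letters v) a b))"
    by (simp add: sum_product rho_sum mult_single rho_single plus_ncword_def)
  also have "\<dots> = (\<Sum>c\<in>UNIV. rho p a c * rho q c b)"
    by (simp add: rho_def sum_product path_append sum_letter smult_add_right sum.distrib mult_smult_left mult_smult_right)
      (simp add: mult.commute)
  finally show ?thesis .
qed

section \<open>The Jacobian determinant of an automorphism is constant\<close>

definition gen_image :: "free_alg \<times> free_alg \<Rightarrow> letter \<Rightarrow> free_alg"
  where "gen_image e z = (case z of LX \<Rightarrow> fst e | LY \<Rightarrow> snd e)"

text \<open>
  The matrix of Fox derivatives with each entry replaced by a block of size 2; in an index the
  first component is the generator and the second one the position in the block.
\<close>

definition jac :: "free_alg \<times> free_alg \<Rightarrow> complex poly^(letter \<times> letter)^(letter \<times> letter)"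
  where "jac e = (\<chi> i j. rho (fox (fst j) (gen_image e (fst i))) (snd i) (snd j))"

lemma sum_pair_letter: "(\<Sum>j\<in>UNIV. F j) = (\<Sum>z\<in>UNIV. \<Sum>c\<in>UNIV. F (z, c))"
  for F :: "letter \<times> letter \<Rightarrow> 'a :: comm_monoid_add"
  by (simp add: sum.cartesian_product flip: UNIV_Times_UNIV)

lemma gen_simps: "gen_x = gen LX" "gen_y = gen LY"
  by (simp_all add: gen_x_def gen_y_def gen_def)

lemma lookup_gen_0: "Poly_Mapping.lookup (gen z) 0 = 0"
  by (simp add: gen_def lookup_single zero_ncword_def)

text \<open>
  The Fox derivatives give this expansion at the origin. Other base points \<open>b\<close> are needed because an
  automorphism may move the augmentation ideal, which is generated by \<open>x\<close> and \<open>y\<close>.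
\<close>

lemma affine_left_expansion:
  fixes t :: free_alg and b :: "letter \<Rightarrow> complex"
  shows "\<exists>c a. t = Poly_Mapping.single 0 c + (\<Sum>j\<in>UNIV. a j * (gen j - Poly_Mapping.single 0 (b j)))"
proof -
  define S where "S = {t. \<exists>c a. t = Poly_Mapping.single 0 c +
    (\<Sum>j\<in>UNIV. a j * (gen j - Poly_Mapping.single 0 (b j)))}"
  have plus: "p + q \<in> S" if "p \<in> S" "q \<in> S" for p q
  proof -
    from that obtain c a c' a' where
      "p = Poly_Mapping.single 0 c + (\<Sum>j\<in>UNIV. a j * (gen j - Poly_Mapping.single 0 (b j)))"
      "q = Poly_Mapping.single 0 c' + (\<Sum>j\<in>UNIV. a' j * (gen j - Poly_Mapping.single 0 (b j)))"
      unfolding S_def by blast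
    then have "p + q = Poly_Mapping.single 0 (c + c') +
        (\<Sum>j\<in>UNIV. (a j + a' j) * (gen j - Poly_Mapping.single 0 (b j)))"
      by (simp add: single_add distrib_right sum.distrib)
    then show ?thesis
      unfolding S_def mem_Collect_eq by (intro exI[of _ "c + c'"] exI[of _ "\<lambda>j. a j + a' j"])
  qed
  have const: "Poly_Mapping.single 0 c \<in> S" for c
    unfolding S_def mem_Collect_eq by (rule exI[of _ c], rule exI[of _ "\<lambda>_. 0"]) simp
  have left: "p * (gen j - Poly_Mapping.single 0 (b j)) \<in> S" for p j
    unfolding S_def mem_Collect_eq
    by (rule exI[of _ 0], rule exI[of _ "\<lambda>k. if k = j then p else 0"]) (cases j; simp add: sum_letter)
  have gen: "gen z * p \<in> S" if "p \<in> S" for z p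
  proof -
    from that obtain c a where p:
      "p = Poly_Mapping.single 0 c + (\<Sum>j\<in>UNIV. a j * (gen j - Poly_Mapping.single 0 (b j)))"
      unfolding S_def by blast
    \<comment> \<open>The summand \<open>c\<close> of \<open>p\<close> contributes \<open>c z = c (z - b\<^sub>z) + c b\<^sub>z\<close>.\<close>
    have "gen z * Poly_Mapping.single 0 c = Poly_Mapping.single 0 c * gen z"
      by (simp add: gen_def mult_single)
    then have "gen z * p = Poly_Mapping.single 0 c * (gen z - Poly_Mapping.single 0 (b z)) +
        (Poly_Mapping.single 0 (c * b z) + ((gen z * a LX) * (gen LX - Poly_Mapping.single 0 (b LX)) +
        (gen z * a LY) * (gen LY - Poly_Mapping.single 0 (b LY))))"
      by (simp add: p sum_letter distrib_left right_diff_distrib mult.assoc mult_single)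
    then show ?thesis using plus left const by metis
  qed
  have word: "Poly_Mapping.single (Word u) k \<in> S" for u k
  proof (induction u)
    case Nil
    then show ?case using const by (simp add: zero_ncword_def)
  next
    case (Cons z u)
    have "Poly_Mapping.single (Word (z # u)) k = gen z * Poly_Mapping.single (Word u) k"
      by (simp add: gen_def mult_single plus_ncword_def)
    then show ?case using gen[OF Cons] by simp
  qed
  have "sum (\<lambda>u. Poly_Mapping.single u (f u)) K \<in> S" if "finite K" for K f
    using that
  proof (induction K rule: finite_induct)
    case empty
    then show ?case using const[of 0] by simp
  next
    case (insert u K)
    then show ?case using plus[OF word[of "letters u" "f u"] insert.IH] by simp
  qed
  then have "t \<in> S" using sum_singles[of t] by (metis finite_keys)
  then show ?thesis unfolding S_def by blast
qed

text \<open>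
  As \<open>\<sigma>\<close> is onto, a generator is \<open>\<sigma>(t)\<close>. Expand \<open>t\<close> at the base point given by the constant terms of
  \<open>\<sigma>(x)\<close> and \<open>\<sigma>(y)\<close>: the images of \<open>x - b\<^sub>x\<close> and \<open>y - b\<^sub>y\<close> then have no constant term, so that
  \<open>fox\<close> is left linear on the resulting expression of the generator.
\<close>

lemma automorphism_fox_inverse:
  assumes "alg_automorphism \<sigma>"
  obtains a where "\<And>i k. (\<Sum>j\<in>UNIV. a i j * fox k (\<sigma> (gen j))) = (if k = i then 1 else 0)"
proof -
  have add: "\<sigma> (p + q) = \<sigma> p + \<sigma> q" and mult: "\<sigma> (p * q) = \<sigma> p * \<sigma> q"
    and scal: "\<sigma> (scal c p) = scal c (\<sigma> p)" and one: "\<sigma> 1 = 1" and "surj \<sigma>" for p q c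
    using assms by (auto simp: alg_automorphism_def bij_def)
  have const: "\<sigma> (Poly_Mapping.single 0 c) = Poly_Mapping.single 0 c" for c
    using scal[of c 1] one by (simp add: scal_def)
  have diff: "\<sigma> (p - q) = \<sigma> p - \<sigma> q" for p q
    using add[of "p - q" q] by simp
  define b where "b j = Poly_Mapping.lookup (\<sigma> (gen j)) 0" for j
  have b0: "Poly_Mapping.lookup (\<sigma> (gen j) - Poly_Mapping.single 0 (b j)) 0 = 0" for j
    by (simp add: b_def lookup_minus)
  have fox_b: "fox k (\<sigma> (gen j) - Poly_Mapping.single 0 (b j)) = fox k (\<sigma> (gen j))" for j k
    using fox_add[of k "\<sigma> (gen j) - Poly_Mapping.single 0 (b j)" "Poly_Mapping.single 0 (b j)"]
    by (simp add: fox_const)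
  have "\<exists>a. \<forall>k. (\<Sum>j\<in>UNIV. a j * fox k (\<sigma> (gen j))) = (if k = i then 1 else 0)" for i
  proof -
    obtain t where t: "gen i = \<sigma> t" using \<open>surj \<sigma>\<close> by (metis surjD)
    obtain c a where "t = Poly_Mapping.single 0 c + (\<Sum>j\<in>UNIV. a j * (gen j - Poly_Mapping.single 0 (b j)))"
      using affine_left_expansion[of t b] by blast
    then have "gen i = Poly_Mapping.single 0 c +
        (\<Sum>j\<in>UNIV. \<sigma> (a j) * (\<sigma> (gen j) - Poly_Mapping.single 0 (b j)))"
      by (simp add: t sum_letter add mult diff const)
    then have "fox k (gen i) = (\<Sum>j\<in>UNIV. \<sigma> (a j) * fox k (\<sigma> (gen j)))" for k
      by (simp add: sum_letter fox_add fox_const fox_mult b0 fox_b)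
    then have "\<forall>k. (\<Sum>j\<in>UNIV. \<sigma> (a j) * fox k (\<sigma> (gen j))) = (if k = i then 1 else 0)"
      by (simp only: fox_gen simp_thms)
    then show ?thesis by (rule exI[of _ "\<lambda>j. \<sigma> (a j)"])
  qed
  then show ?thesis using that by metis
qed

lemma det_jac_unit:
  assumes "alg_automorphism \<sigma>"
  shows "det (jac (\<sigma> gen_x, \<sigma> gen_y)) dvd 1"
proof -
  obtain a where a: "\<And>i k. (\<Sum>j\<in>UNIV. a i j * fox k (\<sigma> (gen j))) = (if k = i then 1 else 0)"
    using automorphism_fox_inverse[OF assms] by blast
  define A :: "complex poly^(letter \<times> letter)^(letter \<times> letter)"
    where "A = (\<chi> i j. rho (a (fst i) (fst j)) (snd i) (snd j))"
  have im: "gen_image (\<sigma> gen_x, \<sigma> gen_y) j = \<sigma> (gen j)" for j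
    by (cases j) (simp_all add: gen_image_def gen_simps)
  have "(A ** jac (\<sigma> gen_x, \<sigma> gen_y)) $ i $ k = mat 1 $ i $ k" for i k
  proof -
    have "(A ** jac (\<sigma> gen_x, \<sigma> gen_y)) $ i $ k = (\<Sum>j\<in>UNIV. \<Sum>c\<in>UNIV.
        rho (a (fst i) j) (snd i) c * rho (fox (fst k) (\<sigma> (gen j))) c (snd k))"
      by (simp add: matrix_matrix_mult_def A_def jac_def im sum_pair_letter)
    also have "\<dots> = rho (\<Sum>j\<in>UNIV. a (fst i) j * fox (fst k) (\<sigma> (gen j))) (snd i) (snd k)"
      by (simp add: rho_sum rho_mult)
    also have "\<dots> = mat 1 $ i $ k"
      by (simp add: a rho_one rho_0 mat_def prod_eq_iff)
    finally show ?thesis .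
  qed
  then have "A ** jac (\<sigma> gen_x, \<sigma> gen_y) = mat 1" by (simp add: vec_eq_iff)
  then have "det A * det (jac (\<sigma> gen_x, \<sigma> gen_y)) = 1" by (metis det_I det_mul)
  then show ?thesis by (metis dvd_triv_right)
qed

definition jac_coeff :: "nat \<Rightarrow> free_alg \<times> free_alg \<Rightarrow> complex"
  where "jac_coeff n e = coeff (det (jac e)) n"

lemma jac_coeff_G:
  assumes "e \<in> G" "0 < n"
  shows "jac_coeff n e = 0"
proof -
  have "det (jac e) dvd 1" using assms(1) det_jac_unit by (auto simp: G_def)
  then have "degree (det (jac e)) = 0" by (metis is_unit_iff_degree not_is_unit_0)
  with assms(2) show ?thesis by (simp add: jac_coeff_def coeff_eq_0)
qed

section \<open>The coefficients of the determinant as equations of \<open>G\<close>\<close>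

definition poly_family :: "'v set \<Rightarrow> ('v \<Rightarrow> complex) set \<Rightarrow> ('v \<Rightarrow> complex poly) \<Rightarrow> bool"
  where "poly_family V L F \<longleftrightarrow> (\<forall>n. (\<lambda>v\<in>V. coeff (F v) n) \<in> poly_fun V L)"

lemma poly_family_const: "poly_family V L (\<lambda>_. q)"
  by (simp add: poly_family_def poly_fun.const)

lemma poly_family_sum:
  "finite S \<Longrightarrow> (\<And>i. i \<in> S \<Longrightarrow> poly_family V L (F i)) \<Longrightarrow> poly_family V L (\<lambda>v. \<Sum>i\<in>S. F i v)"
  unfolding poly_family_def coeff_sum by (auto intro!: poly_fun_sum)

lemma poly_family_mult:
  "poly_family V L F \<Longrightarrow> poly_family V L H \<Longrightarrow> poly_family V L (\<lambda>v. F v * H v)"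
  unfolding poly_family_def coeff_mult by (auto intro!: poly_fun_sum poly_fun_mult')

lemma poly_family_prod:
  "finite S \<Longrightarrow> (\<And>i. i \<in> S \<Longrightarrow> poly_family V L (F i)) \<Longrightarrow> poly_family V L (\<lambda>v. \<Prod>i\<in>S. F i v)"
  by (induction S rule: finite_induct) (simp_all add: poly_family_const poly_family_mult)

lemma poly_family_smult:
  "(\<lambda>v\<in>V. f v) \<in> poly_fun V L \<Longrightarrow> poly_family V L (\<lambda>v. smult (f v) q)"
  unfolding poly_family_def coeff_smult by (auto intro!: poly_fun_mult' poly_fun.const)

lemma poly_family_cong:
  "(\<And>v. v \<in> V \<Longrightarrow> F v = H v) \<Longrightarrow> poly_family V L F \<longleftrightarrow> poly_family V L H"
  unfolding poly_family_def by (auto cong: restrict_cong)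

lemma finite_words_le: "finite {u. length (letters u) \<le> k}"
proof -
  have "{u. length (letters u) \<le> k} = Word ` {l. set l \<subseteq> UNIV \<and> length l \<le> k}"
    by (auto simp: image_iff) (metis ncword.collapse)
  then show ?thesis using finite_lists_length_le[of "UNIV :: letter set" k] by simp
qed

lemma poly_family_jac: "poly_family (E_le k) E_coords (\<lambda>e. jac e $ i $ j)"
proof -
  let ?W = "{u. length (letters u) \<le> k}"
  have "jac e $ i $ j = (\<Sum>u\<in>?W. smult (Poly_Mapping.lookup (gen_image e (fst i)) (Word (letters u @ [fst j])))
      (path (letters u) (snd i) (snd j)))" if "e \<in> E_le k" for e
  proof -
    have "gen_image e (fst i) \<in> R_le k"
      using that by (auto simp: E_le_def gen_image_def split: letter.split)
    then have "length (letters u) \<le> k"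
      if "Poly_Mapping.lookup (fox (fst j) (gen_image e (fst i))) u \<noteq> 0" for u
      using that unfolding R_le_iff lookup_fox
      by (metis Suc_leD length_append_singleton ncword.sel not_le)
    then have "Poly_Mapping.keys (fox (fst j) (gen_image e (fst i))) \<subseteq> ?W"
      by (auto simp: in_keys_iff)
    then show ?thesis
      by (simp add: jac_def rho_superset[OF finite_words_le] lookup_fox)
  qed
  moreover have "poly_family (E_le k) E_coords (\<lambda>e. \<Sum>u\<in>?W.
      smult (Poly_Mapping.lookup (gen_image e (fst i)) (Word (letters u @ [fst j])))
      (path (letters u) (snd i) (snd j)))"
    by (intro poly_family_sum finite_words_le poly_family_smult)
      (cases "fst i"; simp add: gen_image_def poly_fun_E_coord)
  ultimately show ?thesis by (simp cong: poly_family_cong)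
qed

lemma jac_coeff_poly_fun: "(\<lambda>e\<in>E_le k. jac_coeff n e) \<in> poly_fun (E_le k) E_coords"
proof -
  have "poly_family (E_le k) E_coords (\<lambda>e. det (jac e))"
    unfolding det_def
    by (intro poly_family_sum poly_family_mult poly_family_prod poly_family_const poly_family_jac)
      (simp_all add: finite_permutations)
  then show ?thesis by (simp add: poly_family_def jac_coeff_def)
qed

corollary jac_coeff_reduced: "0 < n \<Longrightarrow> (\<lambda>e\<in>E_le k. jac_coeff n e) \<in> reduced_ideal k"
  by (simp add: reduced_ideal_def jac_coeff_poly_fun jac_coeff_G)

section \<open>Tangent directions of the scheme-theoretic fibre\<close>

definition curve :: "free_alg \<times> free_alg \<Rightarrow> free_alg \<times> free_alg \<Rightarrow> complex \<Rightarrow> free_alg \<times> free_alg"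
  where "curve e d s = (fst e + scal s (fst d), snd e + scal s (snd d))"

lemma curve_in_E_le: "e \<in> E_le k \<Longrightarrow> d \<in> E_le k \<Longrightarrow> curve e d s \<in> E_le k"
  by (auto simp: curve_def E_le_def R_le_iff lookup_add lookup_scal)

lemma curve_0: "curve e d 0 = e"
  by (simp add: curve_def scal_def)

lemma scal_mult: "scal c p * q = scal c (p * q)" "p * scal c q = scal c (p * q)"
proof -
  show "scal c p * q = scal c (p * q)" by (simp add: scal_def mult.assoc)
  show "p * scal c q = scal c (p * q)"
    by (rule poly_mapping_eqI) (simp add: lookup_mult_ncword lookup_scal sum_distrib_left algebra_simps)
qed

text \<open>
  The hypothesis says that \<open>d\<close> is in the kernel of the differential of the commutator map at \<open>e\<close>, so
  the commutator moves only to second order.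
\<close>

lemma lookup_comm_curve:
  assumes "fst d * snd e - snd e * fst d + (fst e * snd d - snd d * fst e) = 0"
  shows "Poly_Mapping.lookup (comm (curve e d s)) u =
    Poly_Mapping.lookup (comm e) u + s\<^sup>2 * Poly_Mapping.lookup (comm d) u"
proof -
  have "Poly_Mapping.lookup (comm (curve e d s)) u = Poly_Mapping.lookup (comm e) u
    + s * Poly_Mapping.lookup (fst d * snd e - snd e * fst d + (fst e * snd d - snd d * fst e)) u
    + s\<^sup>2 * Poly_Mapping.lookup (comm d) u"
    by (simp add: comm_def curve_def distrib_left distrib_right scal_mult lookup_add lookup_minus
        lookup_scal power2_eq_square algebra_simps)
  then show ?thesis unfolding assms by simp
qed

lemma poly_fun_differentiable_on_curve:
  assumes "f \<in> poly_fun (E_le k) E_coords" "e \<in> E_le k" "d \<in> E_le k"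
  shows "\<exists>D. ((\<lambda>s. f (curve e d s)) has_field_derivative D) (at 0)"
  using assms(1)
proof (induction rule: poly_fun.induct)
  case (coordinate l)
  then obtain u where "l = (\<lambda>e. Poly_Mapping.lookup (fst e) u) \<or> l = (\<lambda>e. Poly_Mapping.lookup (snd e) u)"
    by (auto simp: E_coords_def)
  then show ?case
    by (elim disjE; simp add: curve_in_E_le assms(2,3))
      (auto simp: curve_def lookup_add lookup_scal intro!: exI derivative_eq_intros)
next
  case (add f g)
  then show ?case using DERIV_add by (simp add: curve_in_E_le assms(2,3)) blast
next
  case (mult f g)
  then show ?case using DERIV_mult by (simp add: curve_in_E_le assms(2,3)) blast
qed (auto simp: curve_in_E_le assms(2,3) intro!: exI derivative_eq_intros)

lemma poly_fun_comm_curve_stationary: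
  assumes "f \<in> poly_fun (R_le (2 * k)) R_coords" "e \<in> E_le k" "d \<in> E_le k"
    and "fst d * snd e - snd e * fst d + (fst e * snd d - snd d * fst e) = 0"
  shows "((\<lambda>s. f (comm (curve e d s))) has_field_derivative 0) (at 0)"
  using assms(1)
proof (induction rule: poly_fun.induct)
  case (const c)
  then show ?case by (simp add: comm_in_R_le curve_in_E_le assms(2,3))
next
  case (coordinate l)
  then obtain u where l: "l = (\<lambda>p. Poly_Mapping.lookup p u)" by (auto simp: R_coords_def)
  show ?case
    by (auto simp: l comm_in_R_le curve_in_E_le assms(2,3) lookup_comm_curve[OF assms(4)]
        intro!: derivative_eq_intros)
next
  case (add f g)
  then show ?case using DERIV_add[OF add.IH] by (simp add: comm_in_R_le curve_in_E_le assms(2,3))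
next
  case (mult f g)
  then show ?case using DERIV_mult[OF mult.IH] by (simp add: comm_in_R_le curve_in_E_le assms(2,3))
qed

text \<open>
  The functions that vanish to first order at \<open>e\<close> along the curve form an ideal, and by
  \<open>poly_fun_comm_curve_stationary\<close> it contains the generators of the fibre ideal.
\<close>

lemma fibre_ideal_stationary:
  assumes f: "f \<in> fibre_ideal k" and e: "e \<in> E_le k" and d: "d \<in> E_le k" and "comm e = w"
    and tangent: "fst d * snd e - snd e * fst d + (fst e * snd d - snd d * fst e) = 0"
  shows "((\<lambda>s. f (curve e d s)) has_field_derivative 0) (at 0)"
proof -
  let ?I = "{f \<in> poly_fun (E_le k) E_coords. f e = 0 \<and>
    ((\<lambda>s. f (curve e d s)) has_field_derivative 0) (at 0)}"
  interpret cring "CE k" by (rule fun_alg_cring)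
  have "ideal ?I (CE k)"
  proof (rule fun_alg_idealI)
    show "(\<lambda>v\<in>E_le k. 0) \<in> ?I"
      by (auto simp: e poly_fun.const curve_in_E_le[OF e d] simp del: restrict_apply)
         (simp_all add: e curve_in_E_le[OF e d])
  next
    fix f g assume "f \<in> ?I" "g \<in> ?I"
    then show "(\<lambda>v\<in>E_le k. f v + g v) \<in> ?I"
      using DERIV_add[of "\<lambda>s. f (curve e d s)" 0 0 UNIV "\<lambda>s. g (curve e d s)" 0]
      by (simp add: poly_fun.add e curve_in_E_le[OF e d])
  next
    fix f g assume f: "f \<in> poly_fun (E_le k) E_coords" and g: "g \<in> ?I"
    obtain D where "((\<lambda>s. f (curve e d s)) has_field_derivative D) (at 0)"
      using poly_fun_differentiable_on_curve[OF f e d] by blast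
    then have "((\<lambda>s. f (curve e d s) * g (curve e d s)) has_field_derivative D * g (curve e d 0) + 0 * f (curve e d 0)) (at 0)"
      using g by (intro DERIV_mult) auto
    then show "(\<lambda>v\<in>E_le k. f v * g v) \<in> ?I"
      using f g by (simp add: poly_fun.mult e curve_in_E_le[OF e d] curve_0)
  qed auto
  moreover have "comm_pullback k ` max_ideal_w (2 * k) \<subseteq> ?I"
    using poly_fun_comm_curve_stationary[OF _ e d tangent]
    by (auto simp: max_ideal_w_def comm_pullback_poly_fun)
       (simp_all add: comm_pullback_def e curve_in_E_le[OF e d] \<open>comm e = w\<close>)
  ultimately have "fibre_ideal k \<subseteq> ?I"
    unfolding fibre_ideal_def by (rule genideal_minimal)
  then show ?thesis using f by blast
qed

section \<open>A Hamiltonian direction with nonzero divergence\<close>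

definition word :: "letter list \<Rightarrow> free_alg" where "word u = Poly_Mapping.single (Word u) 1"

text \<open>
  The pair \<open>(\<partial>H/\<partial>y, -\<partial>H/\<partial>x)\<close> for the cyclic word \<open>H = xxyxyy\<close>: the cyclic derivative by a letter is
  the sum, over the occurrences of that letter, of the words that remain when \<open>H\<close> is cut
  open there, read from the next letter on.
\<close>

definition hamiltonian_direction :: "free_alg \<times> free_alg"
  where "hamiltonian_direction =
    (word [LX,LY,LY,LX,LX] + word [LY,LX,LX,LY,LX] + word [LX,LX,LY,LX,LY],
     - (word [LX,LY,LX,LY,LY] + word [LY,LX,LY,LY,LX] + word [LY,LY,LX,LX,LY]))"

lemma word_mult: "word u * word v = word (u @ v)"
  by (simp add: word_def mult_single plus_ncword_def)

lemma gen_word: "gen z = word [z]"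
  by (simp add: gen_def word_def)

lemma hamiltonian_direction_tangent:
  "fst hamiltonian_direction * gen_y - gen_y * fst hamiltonian_direction
    + (gen_x * snd hamiltonian_direction - snd hamiltonian_direction * gen_x) = 0"
  by (simp add: hamiltonian_direction_def gen_simps gen_word word_mult algebra_simps)

lemma hamiltonian_direction_degree: "hamiltonian_direction \<in> E_le 5"
  by (auto simp: hamiltonian_direction_def E_le_def R_le_iff word_def lookup_add lookup_minus lookup_uminus
      lookup_single when_def)

lemma fox_word: "fox z (word u) = (if u \<noteq> [] \<and> last u = z then word (butlast u) else 0)"
proof (cases u rule: rev_cases)
  case Nil
  then show ?thesis using fox_const[of z 1] by (simp add: word_def zero_ncword_def)
next
  case (snoc v y)
  have "fox z (word u) = word v * fox z (gen y)"
    using fox_mult[OF lookup_gen_0, of z "word v" y] by (simp add: gen_word word_mult snoc)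
  then show ?thesis by (simp add: fox_gen snoc)
qed

lemma fox_diff: "fox z (p - q) = fox z p - fox z q"
  using fox_add[of z "p - q" q] by simp

lemma fox_uminus: "fox z (- p) = - fox z p"
  using fox_diff[of z 0 p] fox_const[of z 0] by simp

lemma rho_diff: "rho (p - q) a b = rho p a b - rho q a b"
  using rho_add[of "p - q" q] by simp

lemma rho_uminus: "rho (- p) a b = - rho p a b"
  using rho_diff[of 0 p] by (simp add: rho_0)

text \<open>
  Only alternating words act nontrivially. After deletion of the last letter, the only
  such word among those of the direction is \<open>xyxy\<close>, from \<open>xyxyy\<close>; it acts on one diagonal entry
  of the block \<open>(y, y)\<close>.
\<close>

lemma det_jac_curve:
  "det (jac (curve (gen_x, gen_y) hamiltonian_direction s)) = 1 - monom s 4"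
proof -
  let ?J = "jac (curve (gen_x, gen_y) hamiltonian_direction s)"
  have rho_word: "rho (word u) a b = path u a b" for u a b
    by (simp add: word_def rho_single)
  have entry: "?J $ i $ j = (if i = j then if i = (LY, LX) then 1 - monom s 4 else 1 else 0)" for i j
    by (cases i; cases j; (cases "fst i"; cases "snd i"; cases "fst j"; cases "snd j";
      simp add: jac_def gen_image_def curve_def hamiltonian_direction_def gen_simps gen_word
        fox_add fox_diff fox_uminus fox_scal fox_word rho_add rho_diff rho_uminus rho_scal rho_word rho_0
        mult_monom smult_monom numeral_eq_Suc))
  have "det ?J = (\<Prod>i\<in>UNIV. ?J $ i $ i)"
    by (rule det_diagonal) (simp add: entry)
  also have "\<dots> = (\<Prod>i\<in>UNIV. if i = (LY, LX) then 1 - monom s 4 else 1)"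
    by (simp add: entry)
  also have "\<dots> = 1 - monom s 4"
    by (simp add: prod.delta)
  finally show ?thesis .
qed

section \<open>The canonical morphism\<close>

theorem proposition8:
  shows "\<not> ind_isomorphism G_ind GG_ind can_mor"
proof
  assume "ind_isomorphism G_ind GG_ind can_mor"
  \<comment> \<open>The pieces of both ind-schemes start at degree 1, so piece 4 lies in \<open>E_le 5\<close>.\<close>
  then have "\<exists>n\<ge>4. \<forall>f\<in>reduced_ideal (Suc n). restrict f (E_le (Suc 4)) \<in> fibre_ideal (Suc 4)"
    unfolding G_ind_def GG_ind_def can_mor_def
    by (rule closed_ind_scheme_incl_isoD[rotated -1])
      (auto intro: ideal_fibre ideal_reduced E_le_mono[THEN subsetD, rotated]
        restrict_fibre[THEN subsetD] restrict_reduced[THEN subsetD] fibre_subset_reduced[THEN subsetD])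
  then obtain n where n: "4 \<le> n"
    and res: "\<And>f. f \<in> reduced_ideal (Suc n) \<Longrightarrow> restrict f (E_le 5) \<in> fibre_ideal 5"
    by auto
  let ?e = "(gen_x, gen_y)"
  let ?c = "curve ?e hamiltonian_direction"
  have e: "?e \<in> E_le 5"
    by (auto simp: E_le_def R_le_def gen_x_def gen_y_def)
  have "restrict (\<lambda>e\<in>E_le (Suc n). jac_coeff 4 e) (E_le 5) \<in> fibre_ideal 5"
    by (rule res[OF jac_coeff_reduced]) simp
  then have "((\<lambda>s. restrict (\<lambda>e\<in>E_le (Suc n). jac_coeff 4 e) (E_le 5) (?c s)) has_field_derivative 0) (at 0)"
    by (rule fibre_ideal_stationary)
      (use hamiltonian_direction_tangent e hamiltonian_direction_degree in \<open>simp_all add: comm_def w_def\<close>)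
  moreover have "restrict (\<lambda>e\<in>E_le (Suc n). jac_coeff 4 e) (E_le 5) (?c s) = - s" for s
  proof -
    have "?c s \<in> E_le 5" by (rule curve_in_E_le[OF e hamiltonian_direction_degree])
    moreover from this have "?c s \<in> E_le (Suc n)" using E_le_mono[of 5 "Suc n"] n by auto
    ultimately show ?thesis by (simp add: jac_coeff_def det_jac_curve)
  qed
  ultimately have "(uminus has_field_derivative 0) (at (0 :: complex))" by simp
  moreover have "(uminus has_field_derivative - 1) (at (0 :: complex))"
    by (auto intro!: derivative_eq_intros)
  ultimately show False using DERIV_unique by fastforce
qed

end
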